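(* Consider $N=2$ non-interacting fermions on the cuboctahedron graph ($M=12$ vertices) with one-particle Hamiltonian $h=-\Delta$, i.e. $H_0=h\otimes1+1\otimes h$ on $\mathcal{H}_2=\Lambda^2\mathbb{C}^{12}$. The uniform density $\bar\rho=\frac16(1,1,\dots,1)\in\mathcal{P}_{12,2}^+$ is the density of a ground-state ensemble of $H_0$, but it is not pure-state $v$-representable: there is no $v\in\mathbb{R}^{12}$ such that $H_0+V$ has a (pure) ground state $\Psi$ with density $\bar\rho$. Consequently $\tilde F\ne F$ for this system, and the pure-state constrained-search functional $\tilde F$ is not convex.
   Context: Cuboctahedron graph: vertices $1,\dots,12$, with the 24 edges $\{1,2\},\{2,3\},\{3,4\},\{4,1\}$; $\{5,6\},\{6,7\},\{7,8\},\{8,5\}$; $\{5,9\},\{9,6\},\{6,10\},\{10,7\},\{7,11\},\{11,8\},\{8,12\},\{12,5\}$; $\{9,1\},\{1,12\},\{9,2\},\{2,10\},\{10,3\},\{3,11\},\{11,4\},\{4,12\}$ (every vertex has degree 4). The graph Laplacian is $\Delta_{ij}=-d(i)$ if $i=j$ (with $d(i)$ the degree of $i$), $1$ if $i\sim j$, and $0$ otherwise. $\mathcal{H}_2=\Lambda^2\mathbb{C}^{12}$ has orthonormal basis $e_i\wedge e_j$, $i<j$. A potential $v\in\mathbb{R}^{12}$ acts as $V(e_i\wedge e_j)=(v_i+v_j)e_i\wedge e_j$. The density of a normalized $\Psi=\sum_{i<j}\Psi_{(i,j)}e_i\wedge e_j$ is $\rho_k=\sum_{(i,j)\ni k}|\Psi_{(i,j)}|^2$;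 the density of a density matrix $\Gamma$ (positive semidefinite, trace one) is $\rho_k=\mathrm{Tr}(\Gamma\,\hat a_k^\dagger\hat a_k)$, where $\hat a_k^\dagger\hat a_k(e_i\wedge e_j)=e_i\wedge e_j$ if $k\in\{i,j\}$ and $0$ otherwise. $\Gamma$ is a ground-state ensemble of $H$ if $\mathrm{Tr}(\Gamma H)$ equals the smallest eigenvalue of $H$. $\mathcal{P}_{M,N}=\{\rho\in\mathbb{R}^M\mid0\le\rho_i\le1,\sum_i\rho_i=N\}$ and $\mathcal{P}_{M,N}^+$ is the same set with strict inequalities $0<\rho_i<1$. Constrained-search functionals: for $\rho\in\mathcal{P}_{M,N}$, $\tilde F(\rho)=\inf\{\langle\Psi,H_0\Psi\rangle\mid\Psi\in\mathcal{H}_N,\|\Psi\|=1,\Psi\text{ has density }\rho\}$ and $F(\rho)=\inf\{\mathrm{Tr}(\Gamma H_0)\mid\Gamma\text{ a density matrix with density }\rho\}$; both are $+\infty$ on $\mathbb{R}^M\setminus\mathcal{P}_{M,N}$. *)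

theory Defs
  imports "HOL-Analysis.Analysis"
begin

text \<open>
  The vertex set is the numeral type \<open>12\<close> (integers modulo 12), so the numerals
  \<open>1, \<dots>, 12\<close> denote its twelve distinct elements, with \<open>12 = 0\<close>. In the linear order
  of this type the vertex labelled 12 comes first instead of last; this only replaces the basis
  vectors \<open>e\<^sub>j \<and> e\<^sub>1\<^sub>2\<close> below by \<open>e\<^sub>1\<^sub>2 \<and> e\<^sub>j = - e\<^sub>j \<and> e\<^sub>1\<^sub>2\<close>.
\<close>

type_synonym vertex = "12"

definition cuboctahedron_edges :: "vertex set set" where
  "cuboctahedron_edges =
     {{1,2}, {2,3}, {3,4}, {4,1},
      {5,6}, {6,7}, {7,8}, {8,5},
      {5,9}, {9,6}, {6,10}, {10,7}, {7,11}, {11,8}, {8,12}, {12,5},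
      {9,1}, {1,12}, {9,2}, {2,10}, {10,3}, {3,11}, {11,4}, {4,12}}"

definition adjacent :: "vertex \<Rightarrow> vertex \<Rightarrow> bool" where
  "adjacent i j \<longleftrightarrow> {i, j} \<in> cuboctahedron_edges"

definition deg :: "vertex \<Rightarrow> nat" where
  "deg i = card {j. adjacent i j}"

definition laplacian :: "complex ^ vertex ^ vertex" where
  "laplacian = (\<chi> i j. if i = j then - of_nat (deg i) else if adjacent i j then 1 else 0)"

text \<open>
  Elements of \<open>\<Lambda>\<^sup>2 \<complex>\<^sup>1\<^sup>2\<close> are given by their coefficients with respect to the orthonormal basis
  \<open>e\<^sub>i \<and> e\<^sub>j\<close>, \<open>i < j\<close>; operators are given by their matrices in this basis.
\<close>

typedef vpair = "{(i, j). (i::vertex) < j}"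
  morphisms ends Vpair
proof -
  have "(0::vertex) < 1 \<or> (1::vertex) < 0" using linorder_neq_iff[of "0::vertex" 1] by simp
  then show ?thesis by blast
qed

instance vpair :: finite
proof
  have "inj ends" by (simp add: inj_on_def ends_inject)
  then show "finite (UNIV :: vpair set)" by (rule finite_imageD[rotated]) simp
qed

abbreviation lo :: "vpair \<Rightarrow> vertex" where "lo p \<equiv> fst (ends p)"
abbreviation hi :: "vpair \<Rightarrow> vertex" where "hi p \<equiv> snd (ends p)"

type_synonym state = "complex ^ vpair"
type_synonym operator = "complex ^ vpair ^ vpair"

definition inner_prod :: "state \<Rightarrow> state \<Rightarrow> complex" where
  "inner_prod \<Phi> \<Psi> = (\<Sum>p\<in>UNIV. cnj (\<Phi> $ p) * \<Psi> $ p)"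

definition wedge :: "complex ^ vertex \<Rightarrow> complex ^ vertex \<Rightarrow> state" where
  "wedge u w = (\<chi> p. u $ lo p * w $ hi p - u $ hi p * w $ lo p)"

lemma wedge_axis: "wedge (axis (lo p) 1) (axis (hi p) 1) = axis p 1"
proof -
  have less: "lo q < hi q" for q using ends[of q] by (auto simp: case_prod_beta)
  have "lo q = lo p \<and> hi q = hi p \<longleftrightarrow> q = p" for q
    by (metis ends_inject prod_eq_iff)
  moreover have "\<not> (hi q = lo p \<and> lo q = hi p)" for q
    using less[of p] less[of q] by auto
  ultimately show ?thesis
    by (auto simp: vec_eq_iff wedge_def axis_def)
qed

text \<open>
  The restriction of \<open>A \<otimes> 1 + 1 \<otimes> A\<close> to \<open>\<Lambda>\<^sup>2 \<complex>\<^sup>1\<^sup>2\<close> maps \<open>u \<and> w\<close> to \<open>A u \<and> w + u \<and> A w\<close>;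
  column \<open>q\<close> of the matrix is the image of the basis vector \<open>e\<^sub>i \<and> e\<^sub>j\<close> with \<open>(i, j) = ends q\<close>.
\<close>

definition one_body :: "complex ^ vertex ^ vertex \<Rightarrow> operator" where
  "one_body A = (\<chi> p q.
     (let ei = axis (lo q) 1; ej = axis (hi q) 1
      in wedge (A *v ei) ej + wedge ei (A *v ej)) $ p)"

definition H0 :: operator where
  "H0 = one_body (- laplacian)"

definition potential :: "real ^ vertex \<Rightarrow> operator" where
  "potential v = (\<chi> p q. if p = q then of_real (v $ lo q + v $ hi q) else 0)"

definition number_op :: "vertex \<Rightarrow> operator" where
  "number_op k = (\<chi> p q. if p = q \<and> k \<in> {lo q, hi q} then 1 else 0)"

definition pure_density :: "state \<Rightarrow> real ^ vertex" where
  "pure_density \<Psi> = (\<chi> k. \<Sum>p | k \<in> {lo p, hi p}. (cmod (\<Psi> $ p))\<^sup>2)"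

text \<open>
  Over the complex numbers, real nonnegative expectation values force the matrix to be Hermitian.
\<close>

definition pos_semidef :: "operator \<Rightarrow> bool" where
  "pos_semidef \<Gamma> \<longleftrightarrow>
     (\<forall>\<Psi>. inner_prod \<Psi> (\<Gamma> *v \<Psi>) \<in> \<real> \<and> 0 \<le> Re (inner_prod \<Psi> (\<Gamma> *v \<Psi>)))"

definition density_matrix :: "operator \<Rightarrow> bool" where
  "density_matrix \<Gamma> \<longleftrightarrow> pos_semidef \<Gamma> \<and> trace \<Gamma> = 1"

definition has_density :: "operator \<Rightarrow> real ^ vertex \<Rightarrow> bool" where
  "has_density \<Gamma> \<rho> \<longleftrightarrow> (\<forall>k. of_real (\<rho> $ k) = trace (\<Gamma> ** number_op k))"

text \<open>
  Only used for Hermitian matrices, all of whose eigenvalues are real.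
\<close>

definition eigenvalue :: "operator \<Rightarrow> real \<Rightarrow> bool" where
  "eigenvalue H e \<longleftrightarrow> (\<exists>\<Psi>. \<Psi> \<noteq> 0 \<and> H *v \<Psi> = of_real e *s \<Psi>)"

definition smallest_eigenvalue :: "operator \<Rightarrow> real \<Rightarrow> bool" where
  "smallest_eigenvalue H e \<longleftrightarrow> eigenvalue H e \<and> (\<forall>e'. eigenvalue H e' \<longrightarrow> e \<le> e')"

definition ground_state :: "operator \<Rightarrow> state \<Rightarrow> bool" where
  "ground_state H \<Psi> \<longleftrightarrow>
     norm \<Psi> = 1 \<and> (\<exists>e. smallest_eigenvalue H e \<and> H *v \<Psi> = of_real e *s \<Psi>)"

definition ground_state_ensemble :: "operator \<Rightarrow> operator \<Rightarrow> bool" where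
  "ground_state_ensemble H \<Gamma> \<longleftrightarrow>
     density_matrix \<Gamma> \<and> (\<exists>e. smallest_eigenvalue H e \<and> trace (\<Gamma> ** H) = of_real e)"

definition density_domain :: "nat \<Rightarrow> (real ^ 'm) set" where
  "density_domain N = {\<rho>. (\<forall>i. 0 \<le> \<rho> $ i \<and> \<rho> $ i \<le> 1) \<and> (\<Sum>i\<in>UNIV. \<rho> $ i) = real N}"

definition density_domain_strict :: "nat \<Rightarrow> (real ^ 'm) set" where
  "density_domain_strict N =
     {\<rho>. (\<forall>i. 0 < \<rho> $ i \<and> \<rho> $ i < 1) \<and> (\<Sum>i\<in>UNIV. \<rho> $ i) = real N}"

definition F_pure :: "real ^ vertex \<Rightarrow> ereal" where
  "F_pure \<rho> =
     (if \<rho> \<in> density_domain 2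
      then Inf {ereal (Re (inner_prod \<Psi> (H0 *v \<Psi>))) | \<Psi>. norm \<Psi> = 1 \<and> pure_density \<Psi> = \<rho>}
      else \<infinity>)"

definition F_ens :: "real ^ vertex \<Rightarrow> ereal" where
  "F_ens \<rho> =
     (if \<rho> \<in> density_domain 2
      then Inf {ereal (Re (trace (\<Gamma> ** H0))) | \<Gamma>. density_matrix \<Gamma> \<and> has_density \<Gamma> \<rho>}
      else \<infinity>)"

text \<open>
  The library's \<open>convex_on\<close> does not apply to functions with values in \<open>ereal\<close>. Restricting to
  \<open>0 < t < 1\<close> avoids products of \<open>0\<close> and \<open>\<infinity>\<close>.
\<close>

definition convex_ereal :: "('a::real_vector \<Rightarrow> ereal) \<Rightarrow> bool" where
  "convex_ereal f \<longleftrightarrow>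
     (\<forall>x y t. 0 < t \<and> t < 1 \<longrightarrow>
        f ((1 - t) *\<^sub>R x + t *\<^sub>R y) \<le> ereal (1 - t) * f x + ereal t * f y)"

definition uniform_density :: "real ^ vertex" where
  "uniform_density = (\<chi> k. 1 / 6)"

end

theory Submission
  imports Defs
begin

text \<open>
  A two-particle state is encoded by its antisymmetric amplitude matrix \<open>B\<close>, for which
  \<open>\<langle>\<Psi>, H\<^sub>0 \<Psi>\<rangle>\<close> is the sum of the energies \<open>\<langle>b\<^sub>j, h b\<^sub>j\<rangle>\<close> of the columns of \<open>B\<close>. Let \<open>P\<close> be the
  projection onto the constants. The second eigenvalue of \<open>h = -\<Delta>\<close> is 2, so \<open>h \<ge> 2 (1 - P)\<close>, and
  \<open>P B P = 0\<close> gives \<open>\<parallel>P B\<parallel>\<^sup>2 \<le> \<parallel>B\<parallel>\<^sup>2 / 2\<close>; hence \<open>H\<^sub>0 \<ge> 2\<close>. Equality forces \<open>B\<^sub>i\<^sub>j = g\<^sub>i - g\<^sub>j\<close>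
  where \<open>g\<close> is a complex linear form in the positions of the vertices of the cuboctahedron in space.

  Uniform density would then force \<open>|g|\<close> to be constant on the vertices, which makes the three
  coefficients of \<open>g\<close> pairwise orthogonal vectors of equal length in the plane \<open>\<complex>\<close>, hence zero.
  On the other hand, the mixture of the three states \<open>1 \<and> x\<close>, \<open>1 \<and> y\<close>, \<open>1 \<and> z\<close> has energy 2 and uniform
  density. A potential shifts the energies of this mixture and of any \<open>\<Psi>\<close> with uniform density by the
  same amount, so by the variational principle \<open>\<Psi>\<close> can be a ground state of \<open>H\<^sub>0 + V\<close> only if its
  \<open>H\<^sub>0\<close>-energy is at most 2, which is impossible. By compactness the pure-state functional at the
  uniform density exceeds 2, whereas it is at most 2 at the densities of the three states.
\<close>

section \<open>Variational principle and mixtures\<close>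

lemma inner_prod_add_right: "inner_prod \<Phi> (\<Psi> + \<Psi>') = inner_prod \<Phi> \<Psi> + inner_prod \<Phi> \<Psi>'"
  by (simp add: inner_prod_def algebra_simps sum.distrib)

lemma inner_prod_add_left: "inner_prod (\<Phi> + \<Phi>') \<Psi> = inner_prod \<Phi> \<Psi> + inner_prod \<Phi>' \<Psi>"
  by (simp add: inner_prod_def algebra_simps sum.distrib)

lemma inner_prod_scale_right: "inner_prod \<Phi> (c *s \<Psi>) = c * inner_prod \<Phi> \<Psi>"
  by (simp add: inner_prod_def algebra_simps sum_distrib_left)

lemma inner_prod_scale_left: "inner_prod (c *s \<Phi>) \<Psi> = cnj c * inner_prod \<Phi> \<Psi>"
  by (simp add: inner_prod_def algebra_simps sum_distrib_left)

lemma cnj_inner_prod: "cnj (inner_prod \<Phi> \<Psi>) = inner_prod \<Psi> \<Phi>"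
  by (simp add: inner_prod_def algebra_simps)

lemma norm_state_squared: "(norm (\<Psi> :: state))\<^sup>2 = (\<Sum>p\<in>UNIV. (cmod (\<Psi> $ p))\<^sup>2)"
  by (simp add: norm_vec_def L2_set_def sum_nonneg)

lemma inner_prod_self: "inner_prod \<Psi> \<Psi> = of_real ((norm \<Psi>)\<^sup>2)"
  unfolding norm_state_squared inner_prod_def of_real_sum complex_norm_square
  by (simp add: mult.commute)

lemma norm_scale: "norm (c *s (\<Psi> :: state)) = cmod c * norm \<Psi>"
proof -
  have "(norm (c *s \<Psi>))\<^sup>2 = (cmod c * norm \<Psi>)\<^sup>2"
    by (simp add: norm_state_squared power_mult_distrib norm_mult sum_distrib_left)
  then show ?thesis by (simp add: power2_eq_iff_nonneg)
qed

section \<open>The variational principle for Hermitian matrices\<close>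

definition hermitian :: "operator \<Rightarrow> bool" where
  "hermitian H \<longleftrightarrow> (\<forall>p q. H $ p $ q = cnj (H $ q $ p))"

lemma hermitian_inner_prod:
  assumes "hermitian H"
  shows "inner_prod \<Phi> (H *v \<Psi>) = inner_prod (H *v \<Phi>) \<Psi>"
proof -
  have h: "cnj (H $ p $ q) = H $ q $ p" for p q
    using assms unfolding hermitian_def by metis
  have "inner_prod (H *v \<Phi>) \<Psi> = (\<Sum>p\<in>UNIV. \<Sum>q\<in>UNIV. cnj (H $ p $ q) * cnj (\<Phi> $ q) * \<Psi> $ p)"
    by (simp add: inner_prod_def matrix_vector_mult_def sum_distrib_right)
  also have "\<dots> = (\<Sum>q\<in>UNIV. \<Sum>p\<in>UNIV. H $ q $ p * cnj (\<Phi> $ q) * \<Psi> $ p)"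
    by (subst sum.swap) (simp add: h)
  also have "\<dots> = inner_prod \<Phi> (H *v \<Psi>)"
    by (simp add: inner_prod_def matrix_vector_mult_def sum_distrib_left mult_ac)
  finally show ?thesis by simp
qed

lemma continuous_on_energy: "continuous_on S (\<lambda>\<Psi>. Re (inner_prod \<Psi> (H *v \<Psi>)))"
  unfolding inner_prod_def matrix_vector_mult_def vec_lambda_beta
  by (intro continuous_intros)

lemma energy_scale:
  "Re (inner_prod (c *s \<Psi>) (H *v (c *s \<Psi>))) = (cmod c)\<^sup>2 * Re (inner_prod \<Psi> (H *v \<Psi>))"
proof -
  have "inner_prod (c *s \<Psi>) (H *v (c *s \<Psi>)) = (cnj c * c) * inner_prod \<Psi> (H *v \<Psi>)"
    by (simp add: inner_prod_scale_left inner_prod_scale_right vector_scalar_commute mult.assoc)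
  also have "cnj c * c = of_real ((cmod c)\<^sup>2)"
    by (simp only: complex_norm_square mult.commute)
  finally show ?thesis by simp
qed

text \<open>The continuous energy attains its minimum on the compact unit sphere; since it is
  quadratic, rescaling carries the bound to all states.\<close>

lemma minimal_energy_attained:
  obtains \<Phi> where "norm \<Phi> = 1"
    "\<And>\<Psi>. Re (inner_prod \<Phi> (H *v \<Phi>)) * (norm \<Psi>)\<^sup>2 \<le> Re (inner_prod \<Psi> (H *v \<Psi>))"
proof -
  obtain p :: vpair where True by blast
  have "axis p 1 \<in> (sphere 0 1 :: state set)" by simp
  then have "sphere 0 1 \<noteq> ({} :: state set)" by blast
  then obtain \<Phi> :: state where \<Phi>: "\<Phi> \<in> sphere 0 1"
    and min: "\<forall>\<Psi>\<in>sphere 0 1. Re (inner_prod \<Phi> (H *v \<Phi>)) \<le> Re (inner_prod \<Psi> (H *v \<Psi>))"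
    using continuous_attains_inf[OF compact_sphere _ continuous_on_energy] by blast
  have "Re (inner_prod \<Phi> (H *v \<Phi>)) * (norm \<Psi>)\<^sup>2 \<le> Re (inner_prod \<Psi> (H *v \<Psi>))" for \<Psi>
  proof (cases "\<Psi> = 0")
    case True
    then show ?thesis by (simp add: inner_prod_def)
  next
    case False
    define c :: complex where "c = of_real (inverse (norm \<Psi>))"
    have c: "cmod c = inverse (norm \<Psi>)" by (simp add: c_def norm_inverse)
    have "c *s \<Psi> \<in> sphere 0 1" using False by (simp add: norm_scale c)
    then have "Re (inner_prod \<Phi> (H *v \<Phi>)) \<le> (inverse (norm \<Psi>))\<^sup>2 * Re (inner_prod \<Psi> (H *v \<Psi>))"
      using min energy_scale[of c \<Psi> H] c by force
    then show ?thesis using False by (simp add: field_simps)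
  qed
  with \<Phi> show ?thesis by (intro that) auto
qed

text \<open>\<open>q\<close> is a nonnegative quadratic form that vanishes at \<open>\<Phi>\<close>.
  Moving \<open>\<Phi>\<close> along the residual \<open>\<eta>\<close> changes it to first order by
  \<open>2 * t * a\<close>, so \<open>a\<close>, the squared length of the residual, must
  vanish.\<close>

lemma minimiser_eigenvector:
  assumes H: "hermitian H"
    and m: "Re (inner_prod \<Phi> (H *v \<Phi>)) = m * (norm \<Phi>)\<^sup>2"
    and min: "\<And>\<Psi>. m * (norm \<Psi>)\<^sup>2 \<le> Re (inner_prod \<Psi> (H *v \<Psi>))"
  shows "H *v \<Phi> = of_real m *s \<Phi>"
proof -
  define q where "q \<Psi> = Re (inner_prod \<Psi> (H *v \<Psi>)) - m * (norm \<Psi>)\<^sup>2" for \<Psi>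
  define \<eta> where "\<eta> = H *v \<Phi> - of_real m *s \<Phi>"
  define a where "a = (norm \<eta>)\<^sup>2"
  have sq: "(norm \<Psi>)\<^sup>2 = Re (inner_prod \<Psi> \<Psi>)" for \<Psi>
    by (simp add: inner_prod_self)
  have H\<Phi>: "H *v \<Phi> = \<eta> + of_real m *s \<Phi>" by (simp add: \<eta>_def)
  have a: "a = Re (inner_prod \<eta> \<eta>)" by (simp add: a_def sq)
  have Re_comm: "Re (inner_prod \<Phi> \<eta>) = Re (inner_prod \<eta> \<Phi>)"
    by (metis cnj_inner_prod complex_cnj(1) complex.sel(1) cnj.sel(1))
  have expand: "q (\<Phi> + of_real t *s \<eta>) = q \<Phi> + 2 * t * a + t\<^sup>2 * q \<eta>" for t
  proof -
    have "inner_prod \<Phi> (H *v \<eta>) = inner_prod \<eta> \<eta> + of_real m * inner_prod \<Phi> \<eta>"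
      by (simp add: hermitian_inner_prod[OF H] H\<Phi> inner_prod_add_left inner_prod_scale_left)
    moreover have "inner_prod \<eta> (H *v \<Phi>) = inner_prod \<eta> \<eta> + of_real m * inner_prod \<eta> \<Phi>"
      by (simp add: H\<Phi> inner_prod_add_right inner_prod_scale_right)
    ultimately show ?thesis
      unfolding q_def sq
      by (simp add: matrix_vector_right_distrib vector_scalar_commute inner_prod_add_left
          inner_prod_add_right inner_prod_scale_left inner_prod_scale_right Re_comm a
          algebra_simps power2_eq_square)
  qed
  have "q \<Phi> = 0" by (simp add: q_def m)
  have Q: "q \<Psi> \<ge> 0" for \<Psi> using min by (simp add: q_def)
  have "a = 0"
  proof (rule ccontr)
    assume "a \<noteq> 0"
    then have "a > 0" by (simp add: a_def)
    define Q where "Q = q \<eta>"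
    have "Q \<ge> 0" using Q by (simp add: Q_def)
    \<comment> \<open>For positive \<open>Q\<close> the minimum over \<open>t\<close> lies at
      \<open>- a / Q\<close>; replacing \<open>Q\<close> by \<open>Q + 1\<close> keeps the value
      negative and covers \<open>Q = 0\<close>.\<close>
    have "0 \<le> 2 * (- a / (Q + 1)) * a + (- a / (Q + 1))\<^sup>2 * Q"
      using Q[of "\<Phi> + of_real (- a / (Q + 1)) *s \<eta>"]
      unfolding expand \<open>q \<Phi> = 0\<close> Q_def[symmetric] by simp
    also have "\<dots> = - (a\<^sup>2 * (Q + 2) / (Q + 1)\<^sup>2)"
      using \<open>Q \<ge> 0\<close> by (simp add: divide_simps) (simp add: algebra_simps power2_eq_square)
    also have "\<dots> < 0" using \<open>Q \<ge> 0\<close> \<open>a > 0\<close> by simp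
    finally show False by simp
  qed
  then show ?thesis by (simp add: a_def \<eta>_def)
qed

text \<open>The least energy is itself an eigenvalue, because its minimiser is an eigenvector; so
  the smallest eigenvalue cannot exceed it. This takes the place of a spectral
  decomposition.\<close>

lemma smallest_eigenvalue_le_energy:
  assumes "hermitian H" and e: "smallest_eigenvalue H e"
  shows "e * (norm \<Psi>)\<^sup>2 \<le> Re (inner_prod \<Psi> (H *v \<Psi>))"
proof -
  obtain \<Phi> where \<Phi>: "norm \<Phi> = 1"
    "\<And>\<Psi>. Re (inner_prod \<Phi> (H *v \<Phi>)) * (norm \<Psi>)\<^sup>2 \<le> Re (inner_prod \<Psi> (H *v \<Psi>))"
    using minimal_energy_attained[of H] by blast
  define m where "m = Re (inner_prod \<Phi> (H *v \<Phi>))"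
  have "H *v \<Phi> = of_real m *s \<Phi>"
    by (rule minimiser_eigenvector) (use assms \<Phi> in \<open>simp_all add: m_def\<close>)
  with \<Phi>(1) have "eigenvalue H m" unfolding eigenvalue_def by (metis norm_zero zero_neq_one)
  with e have "e \<le> m" by (simp add: smallest_eigenvalue_def)
  then have "e * (norm \<Psi>)\<^sup>2 \<le> m * (norm \<Psi>)\<^sup>2" by (simp add: mult_right_mono)
  also have "\<dots> \<le> Re (inner_prod \<Psi> (H *v \<Psi>))" using \<Phi>(2) by (simp add: m_def)
  finally show ?thesis .
qed

section \<open>Equal-weight mixtures of pure states\<close>

definition mixture :: "('a::finite \<Rightarrow> state) \<Rightarrow> operator" where
  "mixture \<Psi> = (\<chi> p q. (\<Sum>a\<in>UNIV. \<Psi> a $ p * cnj (\<Psi> a $ q)) / of_nat CARD('a))"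

lemma trace_mixture:
  fixes \<Psi> :: "'a::finite \<Rightarrow> state"
  shows "trace (mixture \<Psi> ** X) = (\<Sum>a\<in>UNIV. inner_prod (\<Psi> a) (X *v \<Psi> a)) / of_nat CARD('a)"
proof -
  have "trace (mixture \<Psi> ** X) =
    (\<Sum>p\<in>UNIV. \<Sum>q\<in>UNIV. (\<Sum>a\<in>UNIV. \<Psi> a $ p * cnj (\<Psi> a $ q)) / of_nat CARD('a) * X $ q $ p)"
    by (simp add: trace_def matrix_matrix_mult_def mixture_def)
  also have "\<dots> = (\<Sum>p\<in>UNIV. \<Sum>q\<in>UNIV. \<Sum>a\<in>UNIV. cnj (\<Psi> a $ q) * X $ q $ p * \<Psi> a $ p) / of_nat CARD('a)"
    unfolding sum_divide_distrib sum_distrib_right by (intro sum.cong refl) simp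
  also have "(\<Sum>p\<in>UNIV. \<Sum>q\<in>UNIV. \<Sum>a\<in>UNIV. cnj (\<Psi> a $ q) * X $ q $ p * \<Psi> a $ p) =
      (\<Sum>q\<in>UNIV. \<Sum>a\<in>UNIV. \<Sum>p\<in>UNIV. cnj (\<Psi> a $ q) * X $ q $ p * \<Psi> a $ p)"
    by (subst sum.swap) (rule sum.cong[OF refl], rule sum.swap)
  also have "\<dots> = (\<Sum>a\<in>UNIV. \<Sum>q\<in>UNIV. \<Sum>p\<in>UNIV. cnj (\<Psi> a $ q) * X $ q $ p * \<Psi> a $ p)"
    by (rule sum.swap)
  also have "\<dots> = (\<Sum>a\<in>UNIV. inner_prod (\<Psi> a) (X *v \<Psi> a))"
    by (simp add: inner_prod_def matrix_vector_mult_def sum_distrib_left mult.assoc)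
  finally show ?thesis .
qed

text \<open>Every summand of the mixture has rank at most one and contributes a squared modulus,
  which makes positivity visible.\<close>

lemma inner_prod_mixture:
  fixes \<Psi> :: "'a::finite \<Rightarrow> state"
  shows "inner_prod \<Phi> (mixture \<Psi> *v \<Phi>) =
    of_real ((\<Sum>a\<in>UNIV. (cmod (inner_prod (\<Psi> a) \<Phi>))\<^sup>2) / real CARD('a))"
proof -
  have "inner_prod \<Phi> (mixture \<Psi> *v \<Phi>) =
    (\<Sum>p\<in>UNIV. \<Sum>q\<in>UNIV. \<Sum>a\<in>UNIV. cnj (\<Phi> $ p) * \<Psi> a $ p * (cnj (\<Psi> a $ q) * \<Phi> $ q)) / of_nat CARD('a)"
    by (simp add: inner_prod_def matrix_vector_mult_def mixture_def
        sum_divide_distrib sum_distrib_left sum_distrib_right mult_ac)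
  also have "(\<Sum>p\<in>UNIV. \<Sum>q\<in>UNIV. \<Sum>a\<in>UNIV. cnj (\<Phi> $ p) * \<Psi> a $ p * (cnj (\<Psi> a $ q) * \<Phi> $ q)) =
    (\<Sum>p\<in>UNIV. \<Sum>a\<in>UNIV. \<Sum>q\<in>UNIV. cnj (\<Phi> $ p) * \<Psi> a $ p * (cnj (\<Psi> a $ q) * \<Phi> $ q))"
    by (rule sum.cong[OF refl], rule sum.swap)
  also have "\<dots> = (\<Sum>a\<in>UNIV. \<Sum>p\<in>UNIV. \<Sum>q\<in>UNIV. cnj (\<Phi> $ p) * \<Psi> a $ p * (cnj (\<Psi> a $ q) * \<Phi> $ q))"
    by (rule sum.swap)
  also have "\<dots> = (\<Sum>a\<in>UNIV. inner_prod \<Phi> (\<Psi> a) * inner_prod (\<Psi> a) \<Phi>)"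
    by (simp add: inner_prod_def sum_product)
  also have "\<dots> = (\<Sum>a\<in>UNIV. of_real ((cmod (inner_prod (\<Psi> a) \<Phi>))\<^sup>2))"
    by (simp only: complex_norm_square cnj_inner_prod mult.commute)
  finally show ?thesis by simp
qed

lemma density_matrix_mixture:
  fixes \<Psi> :: "'a::finite \<Rightarrow> state"
  assumes "\<And>a. norm (\<Psi> a) = 1"
  shows "density_matrix (mixture \<Psi>)"
proof -
  have "trace (mixture \<Psi>) = 1"
    using trace_mixture[of \<Psi> "mat 1"] assms by (simp add: inner_prod_self)
  moreover have "pos_semidef (mixture \<Psi>)"
    unfolding pos_semidef_def inner_prod_mixture by (simp add: sum_nonneg)
  ultimately show ?thesis by (simp add: density_matrix_def)
qed

lemma expectation_number_op:
  "inner_prod \<Psi> (number_op k *v \<Psi>) = of_real (pure_density \<Psi> $ k)"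
proof -
  have "(number_op k *v \<Psi>) $ p = (if k \<in> {lo p, hi p} then \<Psi> $ p else 0)" for p
  proof -
    have "(number_op k *v \<Psi>) $ p =
        (\<Sum>q\<in>UNIV. if p = q then (if k \<in> {lo q, hi q} then \<Psi> $ q else 0) else 0)"
      unfolding number_op_def matrix_vector_mult_def vec_lambda_beta
      by (intro sum.cong) auto
    then show ?thesis by simp
  qed
  then have "inner_prod \<Psi> (number_op k *v \<Psi>) =
      (\<Sum>p\<in>UNIV. if k \<in> {lo p, hi p} then cnj (\<Psi> $ p) * \<Psi> $ p else 0)"
    unfolding inner_prod_def by (intro sum.cong) auto
  also have "\<dots> = (\<Sum>p | k \<in> {lo p, hi p}. cnj (\<Psi> $ p) * \<Psi> $ p)"
    by (subst sum.inter_filter[symmetric]) auto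
  also have "\<dots> = of_real (pure_density \<Psi> $ k)"
    unfolding pure_density_def vec_lambda_beta of_real_sum complex_norm_square
    by (simp only: mult.commute)
  finally show ?thesis .
qed

lemma lo_less_hi: "lo p < hi p"
  using ends[of p] by (auto simp: case_prod_beta)

text \<open>Exchanging the sums over pairs and vertices shows that a potential sees only the
  density, so it shifts all states of equal density alike.\<close>

lemma expectation_potential:
  "inner_prod \<Psi> (potential v *v \<Psi>) = of_real (\<Sum>k\<in>UNIV. v $ k * pure_density \<Psi> $ k)"
proof -
  have "(potential v *v \<Psi>) $ p = of_real (v $ lo p + v $ hi p) * \<Psi> $ p" for p
    unfolding potential_def matrix_vector_mult_def
    by (simp add: if_distrib[of "\<lambda>x. x * _"] cong: if_cong)
  then have "inner_prod \<Psi> (potential v *v \<Psi>) =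
      (\<Sum>p\<in>UNIV. of_real (v $ lo p + v $ hi p) * (\<Psi> $ p * cnj (\<Psi> $ p)))"
    unfolding inner_prod_def by (intro sum.cong) auto
  also have "\<dots> = of_real (\<Sum>p\<in>UNIV. (v $ lo p + v $ hi p) * (cmod (\<Psi> $ p))\<^sup>2)"
    by (simp only: of_real_sum of_real_mult complex_norm_square)
  also have "(\<Sum>p\<in>UNIV. (v $ lo p + v $ hi p) * (cmod (\<Psi> $ p))\<^sup>2) =
      (\<Sum>p\<in>UNIV. \<Sum>k | k \<in> {lo p, hi p}. v $ k * (cmod (\<Psi> $ p))\<^sup>2)"
  proof (rule sum.cong[OF refl])
    fix p
    have "{k. k \<in> {lo p, hi p}} = {lo p, hi p}" "lo p \<noteq> hi p"
      using lo_less_hi[of p] by auto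
    then show "(v $ lo p + v $ hi p) * (cmod (\<Psi> $ p))\<^sup>2 =
        (\<Sum>k | k \<in> {lo p, hi p}. v $ k * (cmod (\<Psi> $ p))\<^sup>2)"
      by (simp only: sum.insert sum.empty finite.intros) (simp add: algebra_simps)
  qed
  also have "\<dots> = (\<Sum>k\<in>UNIV. \<Sum>p | k \<in> {lo p, hi p}. v $ k * (cmod (\<Psi> $ p))\<^sup>2)"
    using sum.swap_restrict[of UNIV UNIV "\<lambda>p k. v $ k * (cmod (\<Psi> $ p))\<^sup>2" "\<lambda>p k. k \<in> {lo p, hi p}"]
    by simp
  also have "\<dots> = (\<Sum>k\<in>UNIV. v $ k * pure_density \<Psi> $ k)"
    by (simp add: pure_density_def sum_distrib_left)
  finally show ?thesis .
qed

section \<open>Amplitude matrices and one-body operators\<close>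

text \<open>Each basis pair contributes its coefficient above the diagonal and the negative below.
  Writing this as a sum over pairs makes linearity in \<open>\<Psi>\<close> immediate.\<close>

definition amplitude :: "state \<Rightarrow> vertex \<Rightarrow> vertex \<Rightarrow> complex" where
  "amplitude \<Psi> i j = (\<Sum>q\<in>UNIV. \<Psi> $ q * (of_bool (i = lo q \<and> j = hi q) - of_bool (i = hi q \<and> j = lo q)))"

lemma lo_neq_hi: "lo p \<noteq> hi p" "hi p \<noteq> lo p"
  using lo_less_hi[of p] by simp_all

lemma amplitude_antisym: "amplitude \<Psi> j i = - amplitude \<Psi> i j"
  unfolding amplitude_def sum_negf[symmetric] by (simp only: mult_minus_right[symmetric] minus_diff_eq conj_commute)

lemma amplitude_diag [simp]: "amplitude \<Psi> i i = 0"
  using amplitude_antisym[of \<Psi> i i] by (simp add: eq_neg_iff_add_eq_0)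

lemma amplitude_ends: "amplitude \<Psi> (lo p) (hi p) = \<Psi> $ p"
proof -
  have "amplitude \<Psi> (lo p) (hi p) = (\<Sum>q\<in>UNIV. if p = q then \<Psi> $ q else 0)"
    unfolding amplitude_def
  proof (intro sum.cong refl)
    fix q
    have "lo p = lo q \<and> hi p = hi q \<longleftrightarrow> p = q"
      by (metis ends_inject prod_eq_iff)
    moreover have "\<not> (lo p = hi q \<and> hi p = lo q)"
      using lo_less_hi[of p] lo_less_hi[of q] by auto
    ultimately show "\<Psi> $ q * (of_bool (lo p = lo q \<and> hi p = hi q) - of_bool (lo p = hi q \<and> hi p = lo q))
        = (if p = q then \<Psi> $ q else 0)" by auto
  qed
  then show ?thesis by simp
qed

lemma vertex_pair_cases:
  fixes i j :: vertex
  obtains (diag) "i = j" | (up) p where "i = lo p" "j = hi p" | (down) p where "i = hi p" "j = lo p"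
proof -
  have "\<exists>p. i = lo p \<and> j = hi p" if "i < j" for i j :: vertex
    using that Vpair_inverse[of "(i, j)"] by (intro exI[of _ "Vpair (i, j)"]) simp
  then show ?thesis using that by (metis linorder_less_linear)
qed

text \<open>Antisymmetry fixes the diagonal and the lower entries, so an amplitude matrix is
  identified by comparing the entries at the ends of pairs.\<close>

lemma amplitude_unique:
  assumes anti: "\<And>i j. f j i = - f i j" and ends: "\<And>p. f (lo p) (hi p) = \<Psi> $ p"
  shows "amplitude \<Psi> i j = f i j"
proof -
  have "f i i = 0" for i using anti[of i i] by (simp add: eq_neg_iff_add_eq_0)
  then show ?thesis
    by (cases i j rule: vertex_pair_cases)
      (simp_all add: amplitude_ends ends amplitude_antisym[of _ "hi _" "lo _"] anti[of "hi _" "lo _"])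
qed

lemma state_eqI: "(\<And>i j. amplitude \<Phi> i j = amplitude \<Psi> i j) \<Longrightarrow> \<Phi> = \<Psi>"
  by (metis amplitude_ends vec_eq_iff)

lemma amplitude_wedge: "amplitude (wedge u w) i j = u $ i * w $ j - u $ j * w $ i"
  by (rule amplitude_unique) (simp_all add: wedge_def)

lemma sum_over_pairs:
  fixes f :: "vertex \<Rightarrow> vertex \<Rightarrow> 'a::comm_ring_1"
  assumes sym: "\<And>i j. f j i = f i j" and diag: "\<And>i. f i i = 0"
  shows "(\<Sum>i\<in>UNIV. \<Sum>j\<in>UNIV. f i j) = 2 * (\<Sum>p\<in>UNIV. f (lo p) (hi p))"
proof -
  let ?up = "range (\<lambda>p. (lo p, hi p))" and ?down = "range (\<lambda>p. (hi p, lo p))"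
    and ?diag = "range (\<lambda>i::vertex. (i, i))"
  have inj: "inj (\<lambda>p. (lo p, hi p))" "inj (\<lambda>p. (hi p, lo p))"
    by (auto simp: inj_on_def ends_inject[symmetric] prod_eq_iff)
  have "(\<Sum>i\<in>UNIV. \<Sum>j\<in>UNIV. f i j) = (\<Sum>x\<in>UNIV. case_prod f x)"
    by (simp add: sum.cartesian_product)
  also have "(UNIV :: (vertex \<times> vertex) set) = (?up \<union> ?down) \<union> ?diag"
  proof -
    have "x \<in> (?up \<union> ?down) \<union> ?diag" for x :: "vertex \<times> vertex"
      by (cases x, cases "fst x" "snd x" rule: vertex_pair_cases) auto
    then show ?thesis by blast
  qed
  also have "sum (case_prod f) \<dots> = sum (case_prod f) (?up \<union> ?down) + sum (case_prod f) ?diag"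
    by (rule sum.union_disjoint) (use lo_neq_hi in \<open>auto, metis fst_conv snd_conv\<close>)
  also have "sum (case_prod f) ?diag = 0"
    by (rule sum.neutral) (auto simp: diag)
  also have "sum (case_prod f) (?up \<union> ?down) = sum (case_prod f) ?up + sum (case_prod f) ?down"
  proof (rule sum.union_disjoint)
    have "(lo p, hi p) \<noteq> (hi q, lo q)" for p q
      using lo_less_hi[of p] lo_less_hi[of q] by auto
    then show "?up \<inter> ?down = {}" by blast
  qed simp_all
  also have "sum (case_prod f) ?up = (\<Sum>p\<in>UNIV. f (lo p) (hi p))"
    by (subst sum.reindex[OF inj(1)]) (simp add: case_prod_beta)
  also have "sum (case_prod f) ?down = (\<Sum>p\<in>UNIV. f (lo p) (hi p))"
    by (simp add: sum.reindex[OF inj(2)] sym[of "hi _" "lo _"])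
  finally show ?thesis by simp
qed

lemma norm_state_amplitude:
  "2 * (norm \<Psi>)\<^sup>2 = (\<Sum>i\<in>UNIV. \<Sum>j\<in>UNIV. (cmod (amplitude \<Psi> i j))\<^sup>2)"
proof -
  have "cmod (amplitude \<Psi> j i) = cmod (amplitude \<Psi> i j)" for i j
    by (metis amplitude_antisym norm_minus_cancel)
  then show ?thesis
    by (subst sum_over_pairs) (simp_all add: norm_state_squared amplitude_ends)
qed

lemma pure_density_amplitude:
  "pure_density \<Psi> $ k = (\<Sum>j\<in>UNIV. (cmod (amplitude \<Psi> k j))\<^sup>2)"
proof -
  \<comment> \<open>The indicator of row \<open>k\<close> is not symmetric;
    \<open>sum_over_pairs\<close> is applied to \<open>?g\<close> plus its transpose, which doubles
    the row sum.\<close>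
  let ?g = "\<lambda>i j. if k = i then (cmod (amplitude \<Psi> i j))\<^sup>2 else 0"
  have swap: "cmod (amplitude \<Psi> j i) = cmod (amplitude \<Psi> i j)" for i j
    by (metis amplitude_antisym norm_minus_cancel)
  have "2 * pure_density \<Psi> $ k = 2 * (\<Sum>p\<in>UNIV. ?g (lo p) (hi p) + ?g (hi p) (lo p))"
  proof -
    have "(\<Sum>p | k \<in> {lo p, hi p}. (cmod (\<Psi> $ p))\<^sup>2) =
        (\<Sum>p\<in>UNIV. if k \<in> {lo p, hi p} then (cmod (\<Psi> $ p))\<^sup>2 else 0)"
      by (subst sum.inter_filter[symmetric]) auto
    also have "\<dots> = (\<Sum>p\<in>UNIV. ?g (lo p) (hi p) + ?g (hi p) (lo p))"
      by (intro sum.cong refl) (auto simp: amplitude_ends swap[of "hi _" "lo _"] lo_neq_hi)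
    finally show ?thesis by (simp add: pure_density_def)
  qed
  also have "\<dots> = (\<Sum>i\<in>UNIV. \<Sum>j\<in>UNIV. ?g i j + ?g j i)"
    by (rule sum_over_pairs[symmetric]) auto
  also have "\<dots> = (\<Sum>i\<in>UNIV. \<Sum>j\<in>UNIV. ?g i j) + (\<Sum>i\<in>UNIV. \<Sum>j\<in>UNIV. ?g j i)"
    by (simp only: sum.distrib)
  also have "(\<Sum>i\<in>UNIV. \<Sum>j\<in>UNIV. ?g j i) = (\<Sum>i\<in>UNIV. \<Sum>j\<in>UNIV. ?g i j)"
    by (rule sum.swap)
  also have "(\<Sum>i\<in>UNIV. \<Sum>j\<in>UNIV. ?g i j) = (\<Sum>i\<in>UNIV. if k = i then (\<Sum>j\<in>UNIV. (cmod (amplitude \<Psi> i j))\<^sup>2) else 0)"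
    by (intro sum.cong refl) auto
  finally show ?thesis by simp
qed

section \<open>One-body operators on amplitude matrices\<close>

lemma one_body_entry:
  "one_body A $ p $ q =
    A $ lo p $ lo q * of_bool (hi p = hi q) - A $ hi p $ lo q * of_bool (lo p = hi q)
    + of_bool (lo p = lo q) * A $ hi p $ hi q - of_bool (hi p = lo q) * A $ lo p $ hi q"
proof -
  have unit: "(axis k 1 :: complex ^ vertex) $ i = of_bool (i = k)" for i k
    by (simp add: axis_def)
  have "(A *v axis k 1) $ i = A $ i $ k" for i k
    by (simp add: matrix_vector_mult_def unit)
  then show ?thesis
    by (simp add: one_body_def wedge_def Let_def unit)
qed

lemma one_body_component:
  "(one_body A *v \<Psi>) $ p =
    (\<Sum>k\<in>UNIV. A $ lo p $ k * amplitude \<Psi> k (hi p) + A $ hi p $ k * amplitude \<Psi> (lo p) k)"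
proof -
  have left: "(\<Sum>k\<in>UNIV. A $ i $ k * amplitude \<Psi> k j) =
      (\<Sum>q\<in>UNIV. \<Psi> $ q * (A $ i $ lo q * of_bool (j = hi q) - A $ i $ hi q * of_bool (j = lo q)))" for i j
  proof -
    have "(\<Sum>k\<in>UNIV. A $ i $ k * amplitude \<Psi> k j) =
      (\<Sum>q\<in>UNIV. \<Sum>k\<in>UNIV. (if k = lo q then A $ i $ k * \<Psi> $ q * of_bool (j = hi q) else 0)
        - (if k = hi q then A $ i $ k * \<Psi> $ q * of_bool (j = lo q) else 0))"
      unfolding amplitude_def sum_distrib_left
      by (subst sum.swap) (intro sum.cong refl, auto simp: algebra_simps)
    also have "\<dots> = (\<Sum>q\<in>UNIV. \<Psi> $ q * (A $ i $ lo q * of_bool (j = hi q) - A $ i $ hi q * of_bool (j = lo q)))"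
      by (simp add: sum_subtractf algebra_simps)
    finally show ?thesis .
  qed
  have "(\<Sum>k\<in>UNIV. A $ j $ k * amplitude \<Psi> i k) = - (\<Sum>k\<in>UNIV. A $ j $ k * amplitude \<Psi> k i)" for i j
    unfolding sum_negf[symmetric] by (intro sum.cong refl) (metis amplitude_antisym mult_minus_right)
  then have "(\<Sum>k\<in>UNIV. A $ lo p $ k * amplitude \<Psi> k (hi p) + A $ hi p $ k * amplitude \<Psi> (lo p) k) =
    (\<Sum>q\<in>UNIV. \<Psi> $ q * (A $ lo p $ lo q * of_bool (hi p = hi q) - A $ lo p $ hi q * of_bool (hi p = lo q)))
    - (\<Sum>q\<in>UNIV. \<Psi> $ q * (A $ hi p $ lo q * of_bool (lo p = hi q) - A $ hi p $ hi q * of_bool (lo p = lo q)))"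
    by (simp only: sum.distrib left) simp
  also have "\<dots> = (one_body A *v \<Psi>) $ p"
    unfolding matrix_vector_mult_def vec_lambda_beta one_body_entry sum_subtractf[symmetric]
    by (intro sum.cong refl) (simp add: algebra_simps)
  finally show ?thesis by simp
qed

text \<open>In matrix form, B becomes A B plus B times the transpose of A.
  \<open>one_body_component\<close> gives the entries at pairs, antisymmetry the others.\<close>

lemma amplitude_one_body:
  "amplitude (one_body A *v \<Psi>) i j = (\<Sum>k\<in>UNIV. A $ i $ k * amplitude \<Psi> k j + A $ j $ k * amplitude \<Psi> i k)"
proof (rule amplitude_unique)
  show "(\<Sum>k\<in>UNIV. A $ j $ k * amplitude \<Psi> k i + A $ i $ k * amplitude \<Psi> j k) =
      - (\<Sum>k\<in>UNIV. A $ i $ k * amplitude \<Psi> k j + A $ j $ k * amplitude \<Psi> i k)" for i j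
    unfolding sum_negf[symmetric]
    by (intro sum.cong refl) (simp add: amplitude_antisym[of \<Psi> _ i] amplitude_antisym[of \<Psi> j])
qed (simp add: one_body_component)

lemma one_body_wedge: "one_body A *v wedge u w = wedge (A *v u) w + wedge u (A *v w)"
proof (rule state_eqI)
  have "amplitude (wedge (A *v u) w + wedge u (A *v w)) i j =
      amplitude (wedge (A *v u) w) i j + amplitude (wedge u (A *v w)) i j" for i j
    by (simp add: amplitude_def algebra_simps sum.distrib sum_subtractf)
  moreover have "(A *v x) $ i = (\<Sum>k\<in>UNIV. A $ i $ k * x $ k)" for x i
    by (simp add: matrix_vector_mult_def)
  ultimately show "amplitude (one_body A *v wedge u w) i j = amplitude (wedge (A *v u) w + wedge u (A *v w)) i j" for i j
    by (simp add: amplitude_one_body amplitude_wedge sum.distrib sum_subtractf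
        sum_distrib_left sum_distrib_right algebra_simps)
qed

lemma inner_prod_amplitude:
  "2 * inner_prod \<Phi> \<Psi> = (\<Sum>i\<in>UNIV. \<Sum>j\<in>UNIV. cnj (amplitude \<Phi> i j) * amplitude \<Psi> i j)"
proof -
  have "cnj (amplitude \<Phi> j i) * amplitude \<Psi> j i = cnj (amplitude \<Phi> i j) * amplitude \<Psi> i j" for i j
    by (metis amplitude_antisym complex_cnj_minus minus_mult_minus)
  then show ?thesis
    by (subst sum_over_pairs) (simp_all add: inner_prod_def amplitude_ends)
qed

text \<open>Transposing the antisymmetric amplitude matrix turns the action on the second index into
  that on the first. The two halves coincide and cancel the factor 2 of
  \<open>inner_prod_amplitude\<close>, leaving the one-particle energies of the columns.\<close>

lemma energy_one_body:
  "inner_prod \<Psi> (one_body A *v \<Psi>) =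
    (\<Sum>j\<in>UNIV. \<Sum>i\<in>UNIV. cnj (amplitude \<Psi> i j) * (\<Sum>k\<in>UNIV. A $ i $ k * amplitude \<Psi> k j))"
proof -
  let ?t = "\<lambda>i j. cnj (amplitude \<Psi> i j) * (\<Sum>k\<in>UNIV. A $ i $ k * amplitude \<Psi> k j)"
  have neg: "(\<Sum>k\<in>UNIV. A $ j $ k * amplitude \<Psi> i k) = - (\<Sum>k\<in>UNIV. A $ j $ k * amplitude \<Psi> k i)" for i j
    unfolding sum_negf[symmetric] by (intro sum.cong refl) (metis amplitude_antisym mult_minus_right)
  have "2 * inner_prod \<Psi> (one_body A *v \<Psi>) = (\<Sum>i\<in>UNIV. \<Sum>j\<in>UNIV. ?t i j + ?t j i)"
    unfolding inner_prod_amplitude amplitude_one_body sum.distrib[of "\<lambda>k. A $ _ $ k * amplitude \<Psi> k _"] neg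
    by (intro sum.cong refl) (subst (2) amplitude_antisym, simp add: algebra_simps)
  also have "\<dots> = (\<Sum>i\<in>UNIV. \<Sum>j\<in>UNIV. ?t i j) + (\<Sum>i\<in>UNIV. \<Sum>j\<in>UNIV. ?t j i)"
    by (simp only: sum.distrib)
  also have "(\<Sum>i\<in>UNIV. \<Sum>j\<in>UNIV. ?t i j) = (\<Sum>i\<in>UNIV. \<Sum>j\<in>UNIV. ?t j i)"
    by (rule sum.swap)
  finally show ?thesis by simp
qed

lemma hermitian_one_body:
  assumes "\<And>i j. A $ i $ j = cnj (A $ j $ i)"
  shows "hermitian (one_body A)"
proof -
  have A: "cnj (A $ i $ j) = A $ j $ i" for i j using assms by metis
  show ?thesis
    unfolding hermitian_def
    by (auto simp: one_body_entry A of_bool_def)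
qed

section \<open>The cuboctahedron\<close>

text \<open>
  Vertex 12 is written \<open>0\<close> below, which is its normal form for the simplifier.
\<close>

lemma UNIV_vertex: "(UNIV :: vertex set) = {1,2,3,4,5,6,7,8,9,10,11,0}"
proof -
  have "x \<in> {1,2,3,4,5,6,7,8,9,10,11,0}" for x :: vertex
  proof (cases x rule: bit0_cases)
    case (of_int z)
    then have "z \<in> set [0..11]" by simp
    then have "z \<in> {0,1,2,3,4,5,6,7,8,9,10,11}" by (simp add: upto_rec1 del: set_upto)
    then show ?thesis using of_int(1) by (elim insertE) simp_all
  qed
  then show ?thesis by blast
qed

lemma sum_vertex:
  fixes f :: "vertex \<Rightarrow> 'a::comm_monoid_add"
  shows "(\<Sum>i\<in>UNIV. f i) =
    f 1 + f 2 + f 3 + f 4 + f 5 + f 6 + f 7 + f 8 + f 9 + f 10 + f 11 + f 0"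
proof -
  have "distinct [1,2,3,4,5,6,7,8,9,10,11,0::vertex]" by simp
  then have "(\<Sum>i\<in>set [1,2,3,4,5,6,7,8,9,10,11,0]. f i) = sum_list (map f [1,2,3,4,5,6,7,8,9,10,11,0])"
    by (rule sum_list_distinct_conv_sum_set[symmetric])
  then show ?thesis
    unfolding UNIV_vertex
    by (simp only: list.set list.map sum_list.Cons sum_list.Nil add_0_right add.assoc)
qed

lemma all_vertex:
  "(\<forall>i::vertex. P i) \<longleftrightarrow>
    P 1 \<and> P 2 \<and> P 3 \<and> P 4 \<and> P 5 \<and> P 6 \<and> P 7 \<and> P 8 \<and> P 9 \<and> P 10 \<and> P 11 \<and> P 0"
proof -
  have "(\<forall>i::vertex. P i) \<longleftrightarrow> (\<forall>i\<in>UNIV. P i)" by simp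
  then show ?thesis unfolding UNIV_vertex by (simp only: ball_simps simp_thms)
qed

lemma twelve_eq_zero: "(12 :: vertex) = 0"
  by simp

lemma adjacent_iff:
  "adjacent 1 j \<longleftrightarrow> j \<in> {2, 4, 9, 0}"
  "adjacent 2 j \<longleftrightarrow> j \<in> {1, 3, 9, 10}"
  "adjacent 3 j \<longleftrightarrow> j \<in> {2, 4, 10, 11}"
  "adjacent 4 j \<longleftrightarrow> j \<in> {3, 1, 11, 0}"
  "adjacent 5 j \<longleftrightarrow> j \<in> {6, 8, 9, 0}"
  "adjacent 6 j \<longleftrightarrow> j \<in> {5, 7, 9, 10}"
  "adjacent 7 j \<longleftrightarrow> j \<in> {6, 8, 10, 11}"
  "adjacent 8 j \<longleftrightarrow> j \<in> {7, 5, 11, 0}"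
  "adjacent 9 j \<longleftrightarrow> j \<in> {5, 6, 1, 2}"
  "adjacent 10 j \<longleftrightarrow> j \<in> {6, 7, 2, 3}"
  "adjacent 11 j \<longleftrightarrow> j \<in> {7, 8, 3, 4}"
  "adjacent 0 j \<longleftrightarrow> j \<in> {8, 5, 1, 4}"
  unfolding adjacent_def cuboctahedron_edges_def insert_iff doubleton_eq_iff
  by (simp_all add: twelve_eq_zero)

lemma neighbours:
  "{j. adjacent 1 j} = {2, 4, 9, 0}"
  "{j. adjacent 2 j} = {1, 3, 9, 10}"
  "{j. adjacent 3 j} = {2, 4, 10, 11}"
  "{j. adjacent 4 j} = {1, 3, 11, 0}"
  "{j. adjacent 5 j} = {6, 8, 9, 0}"
  "{j. adjacent 6 j} = {5, 7, 9, 10}"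
  "{j. adjacent 7 j} = {6, 8, 10, 11}"
  "{j. adjacent 8 j} = {5, 7, 11, 0}"
  "{j. adjacent 9 j} = {1, 2, 5, 6}"
  "{j. adjacent 10 j} = {2, 3, 6, 7}"
  "{j. adjacent 11 j} = {3, 4, 7, 8}"
  "{j. adjacent 0 j} = {1, 4, 5, 8}"
  unfolding adjacent_iff by auto

lemma not_adjacent_self: "\<not> adjacent i i"
proof -
  have "\<forall>i. i \<notin> {j. adjacent i j}" unfolding all_vertex neighbours by simp
  then show ?thesis by simp
qed

lemma adjacent_commute: "adjacent i j \<longleftrightarrow> adjacent j i"
  by (simp add: adjacent_def insert_commute)

lemma deg_vertex: "deg i = 4"
proof -
  have "\<forall>i. deg i = 4" unfolding all_vertex deg_def neighbours by simp
  then show ?thesis by simp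
qed

lemma hopping_entry: "(- laplacian) $ i $ j = (if i = j then 4 else 0) - (if adjacent i j then 1 else 0)"
  by (simp add: laplacian_def deg_vertex not_adjacent_self)

lemma hopping_sum:
  "(\<Sum>j\<in>UNIV. (- laplacian) $ i $ j * f j) = 4 * f i - (\<Sum>j | adjacent i j. f j)"
proof -
  have "(\<Sum>j\<in>UNIV. (- laplacian) $ i $ j * f j) =
      (\<Sum>j\<in>UNIV. (if i = j then 4 * f j else 0) - (if adjacent i j then f j else 0))"
    unfolding hopping_entry by (intro sum.cong refl) simp
  also have "\<dots> = 4 * f i - (\<Sum>j | adjacent i j. f j)"
    unfolding sum_subtractf by (subst (2) sum.inter_filter[symmetric]) simp_all
  finally show ?thesis .
qed

section \<open>The spectral gap of the graph Laplacian\<close>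

text \<open>
  Adjacent vertices are at distance \<open>\<surd>2\<close>; the coordinate functions span the eigenspace of
  \<open>-\<Delta>\<close> for the eigenvalue 2.
\<close>

definition position :: "vertex \<Rightarrow> real ^ 3" where
  "position i =
    (if i = 1 then vector [1, 0, 1] else if i = 2 then vector [0, 1, 1]
     else if i = 3 then vector [-1, 0, 1] else if i = 4 then vector [0, -1, 1]
     else if i = 5 then vector [1, 0, -1] else if i = 6 then vector [0, 1, -1]
     else if i = 7 then vector [-1, 0, -1] else if i = 8 then vector [0, -1, -1]
     else if i = 9 then vector [1, 1, 0] else if i = 10 then vector [-1, 1, 0]
     else if i = 11 then vector [-1, -1, 0] else vector [1, -1, 0])"

lemma position_simps [simp]:
  "position 1 = vector [1, 0, 1]" "position 2 = vector [0, 1, 1]"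
  "position 3 = vector [-1, 0, 1]" "position 4 = vector [0, -1, 1]"
  "position 5 = vector [1, 0, -1]" "position 6 = vector [0, 1, -1]"
  "position 7 = vector [-1, 0, -1]" "position 8 = vector [0, -1, -1]"
  "position 9 = vector [1, 1, 0]" "position 10 = vector [-1, 1, 0]"
  "position 11 = vector [-1, -1, 0]" "position 0 = vector [1, -1, 0]"
  unfolding position_def by simp_all

text \<open>
  The first three squares come from the eigenvectors for the eigenvalue 4, which alternate in sign
  around the three equatorial squares; the other six come from the eigenspace for the eigenvalue 6,
  spanned by the alternating vectors on the six square faces, in sums and differences over
  opposite faces.
\<close>

lemma hopping_form_squares:
  fixes x1 x2 x3 x4 x5 x6 x7 x8 x9 x10 x11 x12 :: real
  shows "6 * (x1 * (4 * x1 - (x2 + x4 + x9 + x12)) + x2 * (4 * x2 - (x1 + x3 + x9 + x10))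
     + x3 * (4 * x3 - (x2 + x4 + x10 + x11)) + x4 * (4 * x4 - (x1 + x3 + x11 + x12))
     + x5 * (4 * x5 - (x6 + x8 + x9 + x12)) + x6 * (4 * x6 - (x5 + x7 + x9 + x10))
     + x7 * (4 * x7 - (x6 + x8 + x10 + x11)) + x8 * (4 * x8 - (x5 + x7 + x11 + x12))
     + x9 * (4 * x9 - (x1 + x2 + x5 + x6)) + x10 * (4 * x10 - (x2 + x3 + x6 + x7))
     + x11 * (4 * x11 - (x3 + x4 + x7 + x8)) + x12 * (4 * x12 - (x1 + x4 + x5 + x8)))
    = 12 * (x1^2 + x2^2 + x3^2 + x4^2 + x5^2 + x6^2 + x7^2 + x8^2 + x9^2 + x10^2 + x11^2 + x12^2)
     - (x1 + x2 + x3 + x4 + x5 + x6 + x7 + x8 + x9 + x10 + x11 + x12)^2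
     + 3 * (x9 - x10 + x11 - x12)^2 + 3 * (x2 - x4 - x6 + x8)^2 + 3 * (x1 - x3 - x5 + x7)^2
     + 3 * ((x1 - x2 + x3 - x4) - (x5 - x6 + x7 - x8))^2
     + 3 * ((x1 + x5 - x9 - x12) - (x3 + x7 - x10 - x11))^2
     + 3 * ((x2 + x6 - x9 - x10) - (x4 + x8 - x11 - x12))^2
     + 2 * ((x1 - x2 + x3 - x4) + (x5 - x6 + x7 - x8))^2
     + 2 * ((x1 + x5 - x9 - x12) + (x3 + x7 - x10 - x11))^2
     + 2 * ((x2 + x6 - x9 - x10) + (x4 + x8 - x11 - x12))^2"
  by (simp add: power2_eq_square algebra_simps)

text \<open>\<open>L\<close> is the quadratic form of 2 (1 - P), as P f has squared norm (sum of
  f)^2 / 12. In the equality case all squares of \<open>hopping_form_squares\<close> vanish, which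
  leaves constants and linear functions of the position.\<close>

lemma hopping_form_real:
  fixes f :: "vertex \<Rightarrow> real"
  defines "E \<equiv> \<Sum>i\<in>UNIV. f i * (4 * f i - (\<Sum>j | adjacent i j. f j))"
    and "L \<equiv> 2 * (\<Sum>i\<in>UNIV. (f i)\<^sup>2) - (\<Sum>i\<in>UNIV. f i)\<^sup>2 / 6"
  shows "L \<le> E" and "E \<le> L \<Longrightarrow> \<exists>d c. \<forall>i. f i = d + c \<bullet> position i"
proof -
  have E: "E = f 1 * (4 * f 1 - (f 2 + f 4 + f 9 + f 0)) + f 2 * (4 * f 2 - (f 1 + f 3 + f 9 + f 10))
     + f 3 * (4 * f 3 - (f 2 + f 4 + f 10 + f 11)) + f 4 * (4 * f 4 - (f 1 + f 3 + f 11 + f 0))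
     + f 5 * (4 * f 5 - (f 6 + f 8 + f 9 + f 0)) + f 6 * (4 * f 6 - (f 5 + f 7 + f 9 + f 10))
     + f 7 * (4 * f 7 - (f 6 + f 8 + f 10 + f 11)) + f 8 * (4 * f 8 - (f 5 + f 7 + f 11 + f 0))
     + f 9 * (4 * f 9 - (f 1 + f 2 + f 5 + f 6)) + f 10 * (4 * f 10 - (f 2 + f 3 + f 6 + f 7))
     + f 11 * (4 * f 11 - (f 3 + f 4 + f 7 + f 8)) + f 0 * (4 * f 0 - (f 1 + f 4 + f 5 + f 8))"
    unfolding E_def sum_vertex neighbours by (simp add: add.assoc)
  \<comment> \<open>The arguments follow the order in which the variables first occur in the
    identity; \<open>f 0\<close> stands for \<open>x12\<close>.\<close>
  note E6 = hopping_form_squares[of "f 1" "f 2" "f 4" "f 9" "f 0" "f 3" "f 10" "f 11" "f 5" "f 6" "f 8" "f 7",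
    folded E]
  have L6: "6 * L = 12 * ((f 1)\<^sup>2 + (f 2)\<^sup>2 + (f 3)\<^sup>2 + (f 4)\<^sup>2 + (f 5)\<^sup>2 + (f 6)\<^sup>2 + (f 7)\<^sup>2 + (f 8)\<^sup>2
      + (f 9)\<^sup>2 + (f 10)\<^sup>2 + (f 11)\<^sup>2 + (f 0)\<^sup>2)
     - (f 1 + f 2 + f 3 + f 4 + f 5 + f 6 + f 7 + f 8 + f 9 + f 10 + f 11 + f 0)^2"
    unfolding L_def sum_vertex by simp
  have nonneg: "0 \<le> 3 * x\<^sup>2" "0 \<le> 2 * x\<^sup>2" for x :: real by simp_all
  note squares = nonneg(1)[of "f 9 - f 10 + f 11 - f 0"] nonneg(1)[of "f 2 - f 4 - f 6 + f 8"]
    nonneg(1)[of "f 1 - f 3 - f 5 + f 7"]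
    nonneg(1)[of "(f 1 - f 2 + f 3 - f 4) - (f 5 - f 6 + f 7 - f 8)"]
    nonneg(1)[of "(f 1 + f 5 - f 9 - f 0) - (f 3 + f 7 - f 10 - f 11)"]
    nonneg(1)[of "(f 2 + f 6 - f 9 - f 10) - (f 4 + f 8 - f 11 - f 0)"]
    nonneg(2)[of "(f 1 - f 2 + f 3 - f 4) + (f 5 - f 6 + f 7 - f 8)"]
    nonneg(2)[of "(f 1 + f 5 - f 9 - f 0) + (f 3 + f 7 - f 10 - f 11)"]
    nonneg(2)[of "(f 2 + f 6 - f 9 - f 10) + (f 4 + f 8 - f 11 - f 0)"]
  have "6 * L \<le> 6 * E" using E6 L6 squares by argo
  then show "L \<le> E" by simp
  assume "E \<le> L"
  then have le: "6 * E \<le> 6 * L" by simp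
  have zero: "x = 0" if "3 * x\<^sup>2 \<le> 0 \<or> 2 * x\<^sup>2 \<le> 0" for x :: real
    using that by (simp add: mult_le_0_iff)
  \<comment> \<open>Each weighted square is at most \<open>6 * E - 6 * L\<close>, hence at most 0;
    the disjunction in \<open>zero\<close> covers both weights.\<close>
  have "f 9 - f 10 + f 11 - f 0 = 0" "f 2 - f 4 - f 6 + f 8 = 0" "f 1 - f 3 - f 5 + f 7 = 0"
    "(f 1 - f 2 + f 3 - f 4) - (f 5 - f 6 + f 7 - f 8) = 0"
    "(f 1 + f 5 - f 9 - f 0) - (f 3 + f 7 - f 10 - f 11) = 0"
    "(f 2 + f 6 - f 9 - f 10) - (f 4 + f 8 - f 11 - f 0) = 0"
    "(f 1 - f 2 + f 3 - f 4) + (f 5 - f 6 + f 7 - f 8) = 0"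
    "(f 1 + f 5 - f 9 - f 0) + (f 3 + f 7 - f 10 - f 11) = 0"
    "(f 2 + f 6 - f 9 - f 10) + (f 4 + f 8 - f 11 - f 0) = 0"
    by (rule zero, use E6 L6 squares le in argo)+
  note flat = this
  \<comment> \<open>The coefficients of an affine function, read off from its values at (1,1,0),
    (-1,1,0), (1,-1,0), (1,0,1) and (1,0,-1).\<close>
  let ?d = "(f 10 + f 0) / 2"
    and ?c = "vector [(f 9 - f 10) / 2, (f 9 - f 0) / 2, (f 1 - f 5) / 2] :: real ^ 3"
  have "\<forall>i. f i = ?d + ?c \<bullet> position i"
    unfolding all_vertex by (simp add: inner_vec_def sum_3) (use flat in argo)
  then show "\<exists>d c. \<forall>i. f i = d + c \<bullet> position i" by blast
qed

definition position_form :: "complex ^ 3 \<Rightarrow> vertex \<Rightarrow> complex" where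
  "position_form a i = (\<Sum>m\<in>UNIV. a $ m * of_real (position i $ m))"

text \<open>\<open>- laplacian\<close> is real, so both \<open>E\<close> and \<open>L\<close> split
  into contributions of the real and imaginary parts; equality for the sum forces equality for each
  part.\<close>

lemma hopping_form_complex:
  fixes f :: "vertex \<Rightarrow> complex"
  defines "E \<equiv> Re (\<Sum>i\<in>UNIV. cnj (f i) * (\<Sum>k\<in>UNIV. (- laplacian) $ i $ k * f k))"
    and "L \<equiv> 2 * (\<Sum>i\<in>UNIV. (cmod (f i))\<^sup>2) - (cmod (\<Sum>i\<in>UNIV. f i))\<^sup>2 / 6"
  shows "L \<le> E" and "E \<le> L \<Longrightarrow> \<exists>d a. \<forall>i. f i = d + position_form a i"
proof -
  define E' where "E' g = (\<Sum>i\<in>UNIV. g i * (4 * g i - (\<Sum>j | adjacent i j. g j)))" for g :: "vertex \<Rightarrow> real"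
  define L' where "L' g = 2 * (\<Sum>i\<in>UNIV. (g i)\<^sup>2) - (\<Sum>i\<in>UNIV. g i)\<^sup>2 / 6" for g :: "vertex \<Rightarrow> real"
  let ?x = "\<lambda>i. Re (f i)" and ?y = "\<lambda>i. Im (f i)"
  have E: "E = E' ?x + E' ?y"
    unfolding E_def E'_def hopping_sum by (simp add: sum.distrib)
  have L: "L = L' ?x + L' ?y"
    unfolding L_def L'_def by (simp add: cmod_power2 sum.distrib algebra_simps add_divide_distrib)
  have le: "L' g \<le> E' g" for g
    unfolding E'_def L'_def by (rule hopping_form_real)
  then show "L \<le> E" unfolding E L by (simp add: add_mono)
  assume "E \<le> L"
  then have "E' ?x \<le> L' ?x" "E' ?y \<le> L' ?y"
    using le[of ?x] le[of ?y] unfolding E L by linarith+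
  then obtain d c d' c' where "\<forall>i. ?x i = d + c \<bullet> position i" "\<forall>i. ?y i = d' + c' \<bullet> position i"
    unfolding E'_def L'_def using hopping_form_real(2)[of ?x] hopping_form_real(2)[of ?y] by metis
  then have "f i = Complex d d' + position_form (\<chi> m. Complex (c $ m) (c' $ m)) i" for i
    by (simp add: complex_eq_iff position_form_def inner_vec_def)
  then show "\<exists>d a. \<forall>i. f i = d + position_form a i" by blast
qed

section \<open>Ground states and the uniform density\<close>

text \<open>
  The left-hand side is \<open>\<parallel>(1 - P) B (1 - P)\<parallel>\<^sup>2\<close>, because \<open>P B P = 0\<close>.
\<close>

lemma sum_deviation_antisymmetric:
  fixes B :: "vertex \<Rightarrow> vertex \<Rightarrow> complex"
  assumes anti: "\<And>i j. B j i = - B i j"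
  defines "s \<equiv> \<lambda>j. \<Sum>i\<in>UNIV. B i j"
  shows "(\<Sum>i\<in>UNIV. \<Sum>j\<in>UNIV. (cmod (B i j - (s j - s i) / 12))\<^sup>2) =
    (\<Sum>i\<in>UNIV. \<Sum>j\<in>UNIV. (cmod (B i j))\<^sup>2) - (\<Sum>j\<in>UNIV. (cmod (s j))\<^sup>2) / 6"
proof -
  define S where "S = (\<Sum>j\<in>UNIV. (cmod (s j))\<^sup>2)"
  \<comment> \<open>With row sums \<open>- s i\<close> and total 0, subtracting
    \<open>(s j - s i) / 12\<close> removes column and row means, that is, it applies 1 - P on both
    sides.\<close>
  have row: "(\<Sum>j\<in>UNIV. B i j) = - s i" for i
    unfolding s_def sum_negf[symmetric] by (intro sum.cong refl anti)
  have "(\<Sum>j\<in>UNIV. s j) = - (\<Sum>j\<in>UNIV. s j)"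
    by (subst s_def, subst sum.swap) (simp add: row sum_negf)
  then have sum0: "(\<Sum>j\<in>UNIV. s j) = 0" by (simp add: eq_neg_iff_add_eq_0)
  have norm: "Re (cnj z * z) = (cmod z)\<^sup>2" for z
    unfolding cmod_power2 by (simp add: power2_eq_square)
  have "(\<Sum>i\<in>UNIV. \<Sum>j\<in>UNIV. Re (cnj (B i j) * s j)) = (\<Sum>j\<in>UNIV. Re (cnj (s j) * s j))"
    by (subst sum.swap) (simp only: s_def cnj_sum Re_sum[symmetric] sum_distrib_right)
  then have t1: "(\<Sum>i\<in>UNIV. \<Sum>j\<in>UNIV. Re (cnj (B i j) * s j)) = S"
    by (simp only: norm S_def)
  have "(\<Sum>i\<in>UNIV. \<Sum>j\<in>UNIV. Re (cnj (B i j) * s i)) = (\<Sum>i\<in>UNIV. Re (cnj (\<Sum>j\<in>UNIV. B i j) * s i))"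
    by (simp only: cnj_sum Re_sum[symmetric] sum_distrib_right)
  then have t2: "(\<Sum>i\<in>UNIV. \<Sum>j\<in>UNIV. Re (cnj (B i j) * s i)) = - S"
    unfolding row S_def norm[symmetric] by (simp add: sum_negf[symmetric])
  have "(\<Sum>i\<in>UNIV. \<Sum>j\<in>UNIV. Re (cnj (s i) * s j)) = Re (cnj (\<Sum>i\<in>UNIV. s i) * (\<Sum>j\<in>UNIV. s j))"
    by (simp only: cnj_sum Re_sum[symmetric] sum_product)
  then have t3: "(\<Sum>i\<in>UNIV. \<Sum>j\<in>UNIV. Re (cnj (s i) * s j)) = 0"
    by (simp only: sum0) simp
  have t4: "(\<Sum>i\<in>(UNIV :: vertex set). \<Sum>j\<in>UNIV. (cmod (s j))\<^sup>2) = 12 * S"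
    by (simp add: S_def)
  have t5: "(\<Sum>i\<in>UNIV. \<Sum>j\<in>(UNIV :: vertex set). (cmod (s i))\<^sup>2) = 12 * S"
    by (simp add: S_def sum_distrib_left)
  \<comment> \<open>Summed over \<open>i\<close> and \<open>j\<close>, the terms after the first
    give - S/6 - S/6 + S/12 + S/12 - 0 = - S/6.\<close>
  have "(cmod (b - (t - u) / 12))\<^sup>2 = (cmod b)\<^sup>2 - Re (cnj b * t) / 6 + Re (cnj b * u) / 6
      + (cmod t)\<^sup>2 / 144 + (cmod u)\<^sup>2 / 144 - Re (cnj u * t) / 72" for b t u :: complex
    unfolding cmod_power2 by (simp add: power2_eq_square field_simps)
  then show ?thesis
    by (simp only: sum.distrib sum_subtractf sum_divide_distrib[symmetric] t1 t2 t3 t4 t5 S_def[symmetric])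
       simp
qed

text \<open>The lower bounds for the columns add up to \<open>4 * (norm \<Psi>)\<^sup>2\<close>
  minus the sum of |s j|^2 / 6. By \<open>sum_deviation_antisymmetric\<close> this exceeds
  \<open>2 * (norm \<Psi>)\<^sup>2\<close> by exactly the last sum, so the energy above the bound is
  split into two nonnegative excesses.\<close>

lemma H0_energy_decomposition:
  fixes \<Psi> :: state
  defines "s \<equiv> \<lambda>j. \<Sum>i\<in>UNIV. amplitude \<Psi> i j"
  shows "Re (inner_prod \<Psi> (H0 *v \<Psi>)) = 2 * (norm \<Psi>)\<^sup>2 +
    (\<Sum>j\<in>UNIV. Re (\<Sum>i\<in>UNIV. cnj (amplitude \<Psi> i j) * (\<Sum>k\<in>UNIV. (- laplacian) $ i $ k * amplitude \<Psi> k j))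
      - (2 * (\<Sum>i\<in>UNIV. (cmod (amplitude \<Psi> i j))\<^sup>2) - (cmod (s j))\<^sup>2 / 6)) +
    (\<Sum>i\<in>UNIV. \<Sum>j\<in>UNIV. (cmod (amplitude \<Psi> i j - (s j - s i) / 12))\<^sup>2)"
proof -
  have "(\<Sum>j\<in>UNIV. \<Sum>i\<in>UNIV. (cmod (amplitude \<Psi> i j))\<^sup>2) = 2 * (norm \<Psi>)\<^sup>2"
    by (subst sum.swap) (simp add: norm_state_amplitude)
  then have "(\<Sum>j\<in>UNIV. 2 * (\<Sum>i\<in>UNIV. (cmod (amplitude \<Psi> i j))\<^sup>2)) = 4 * (norm \<Psi>)\<^sup>2"
    by (simp add: sum_distrib_left[symmetric])
  moreover have "(\<Sum>i\<in>UNIV. \<Sum>j\<in>UNIV. (cmod (amplitude \<Psi> i j - (s j - s i) / 12))\<^sup>2) =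
    2 * (norm \<Psi>)\<^sup>2 - (\<Sum>j\<in>UNIV. (cmod (s j))\<^sup>2) / 6"
    unfolding s_def norm_state_amplitude by (rule sum_deviation_antisymmetric) (rule amplitude_antisym)
  ultimately show ?thesis
    unfolding H0_def energy_one_body Re_sum[of _ "UNIV :: vertex set"]
    by (simp only: sum_subtractf sum_divide_distrib[symmetric])
qed

lemma H0_energy_ge: "2 * (norm \<Psi>)\<^sup>2 \<le> Re (inner_prod \<Psi> (H0 *v \<Psi>))"
  unfolding H0_energy_decomposition
  using hopping_form_complex(1)[of "\<lambda>i. amplitude \<Psi> i _"]
  by (simp add: sum_nonneg)

lemma H0_minimiser_amplitude:
  assumes "Re (inner_prod \<Psi> (H0 *v \<Psi>)) \<le> 2 * (norm \<Psi>)\<^sup>2"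
  obtains a where "\<And>i j. amplitude \<Psi> i j = position_form a i - position_form a j"
proof -
  define s where "s j = (\<Sum>i\<in>UNIV. amplitude \<Psi> i j)" for j
  define D where "D j = Re (\<Sum>i\<in>UNIV. cnj (amplitude \<Psi> i j) * (\<Sum>k\<in>UNIV. (- laplacian) $ i $ k * amplitude \<Psi> k j))
      - (2 * (\<Sum>i\<in>UNIV. (cmod (amplitude \<Psi> i j))\<^sup>2) - (cmod (s j))\<^sup>2 / 6)" for j
  define R where "R i j = (cmod (amplitude \<Psi> i j - (s j - s i) / 12))\<^sup>2" for i j
  have D: "0 \<le> D j" for j
    unfolding D_def s_def using hopping_form_complex(1)[of "\<lambda>i. amplitude \<Psi> i j"] by simp
  have R: "0 \<le> R i j" for i j by (simp add: R_def)
  have "(\<Sum>j\<in>UNIV. D j) + (\<Sum>i\<in>UNIV. \<Sum>j\<in>UNIV. R i j) \<le> 0"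
    using assms H0_energy_decomposition[of \<Psi>, folded s_def, folded D_def R_def] by simp
  moreover have "0 \<le> (\<Sum>j\<in>UNIV. D j)" "0 \<le> (\<Sum>i\<in>UNIV. \<Sum>j\<in>UNIV. R i j)"
    by (simp_all add: sum_nonneg D R)
  ultimately have "(\<Sum>j\<in>UNIV. D j) = 0" "(\<Sum>i\<in>UNIV. \<Sum>j\<in>UNIV. R i j) = 0" by linarith+
  then have "D 0 = 0" and "R i j = 0" for i j
    by (simp_all add: sum_nonneg_eq_0_iff sum_nonneg D R)
  then have B: "amplitude \<Psi> i j = (s j - s i) / 12" for i j
    by (simp add: R_def)
  \<comment> \<open>One column suffices: \<open>D 0 = 0\<close> makes it affine in the position, and
    the constant \<open>d\<close> cancels in the difference of two of its entries.\<close>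
  obtain d a where col: "\<forall>i. amplitude \<Psi> i 0 = d + position_form a i"
    using hopping_form_complex(2)[of "\<lambda>i. amplitude \<Psi> i 0"] \<open>D 0 = 0\<close>
    unfolding D_def s_def by fastforce
  have "amplitude \<Psi> i j = position_form a i - position_form a j" for i j
  proof -
    have "amplitude \<Psi> i j = amplitude \<Psi> i 0 - amplitude \<Psi> j 0"
      by (simp add: B diff_divide_distrib)
    then show ?thesis by (simp add: col)
  qed
  then show ?thesis by (rule that)
qed

text \<open>For vectors in the plane, the first three equations express orthogonality; given that,
  the last two say that the lengths agree. Three pairwise orthogonal nonzero vectors do not fit in a
  plane.\<close>

lemma orthogonal_triple_in_plane:
  fixes a b c :: complex
  assumes "cmod (a + b) = cmod (a - b)" "cmod (a + c) = cmod (a - c)" "cmod (b + c) = cmod (b - c)"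
    and "cmod (a + b) = cmod (a + c)" "cmod (a + b) = cmod (b + c)"
  shows "a = 0" "b = 0" "c = 0"
proof -
  define n where "n = (Re a)\<^sup>2 + (Im a)\<^sup>2"
  have sq: "(cmod z)\<^sup>2 = (cmod w)\<^sup>2" if "cmod z = cmod w" for z w using that by simp
  note * = assms[THEN sq, unfolded cmod_power2, simplified, unfolded power2_eq_square]
  have ab: "Re a * Re b + Im a * Im b = 0" and ac: "Re a * Re c + Im a * Im c = 0"
    and bc: "Re b * Re c + Im b * Im c = 0"
    using *(1-3) by (simp_all add: algebra_simps)
  have n: "(Re b)\<^sup>2 + (Im b)\<^sup>2 = n" "(Re c)\<^sup>2 + (Im c)\<^sup>2 = n"
    using *(4,5) ab ac bc unfolding n_def power2_eq_square by (simp_all add: algebra_simps)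
  \<comment> \<open>A nonzero \<open>a\<close> orthogonal to \<open>b\<close> and \<open>c\<close>
    makes these parallel, while Lagrange's identity for the orthogonal \<open>b\<close> and
    \<open>c\<close> gives their determinant the modulus \<open>n\<close>.\<close>
  have "n * (Re b * Im c - Im b * Re c) = 0"
    using ab ac unfolding n_def by algebra
  moreover have "n\<^sup>2 = (Re b * Im c - Im b * Re c)\<^sup>2"
    using bc n by algebra
  ultimately have "n = 0" by auto
  then show "a = 0" "b = 0" "c = 0"
    using n unfolding n_def by (simp_all add: complex_eq_iff sum_power2_eq_zero_iff)
qed

lemma minimal_energy_density_not_uniform:
  assumes "Re (inner_prod \<Psi> (H0 *v \<Psi>)) \<le> 2 * (norm \<Psi>)\<^sup>2"
  shows "pure_density \<Psi> \<noteq> uniform_density"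
proof
  assume uniform: "pure_density \<Psi> = uniform_density"
  obtain a where B: "\<And>i j. amplitude \<Psi> i j = position_form a i - position_form a j"
    using H0_minimiser_amplitude[OF assms] by blast
  let ?g = "position_form a"
  \<comment> \<open>This removes the cross term from the density at \<open>k\<close>, the sum of |g
    k - g j|^2 over \<open>j\<close>, so a uniform density makes |g| constant.\<close>
  have sum0: "(\<Sum>j\<in>UNIV. ?g j) = 0"
    unfolding sum_vertex by (simp add: position_form_def sum_3)
  have "(cmod (z - w))\<^sup>2 = (cmod z)\<^sup>2 + (cmod w)\<^sup>2 - 2 * Re (cnj z * w)" for z w
    unfolding cmod_power2 by (simp add: power2_eq_square algebra_simps)
  then have "1 / 6 = 12 * (cmod (?g k))\<^sup>2 + (\<Sum>j\<in>UNIV. (cmod (?g j))\<^sup>2)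
      - 2 * Re (cnj (?g k) * (\<Sum>j\<in>UNIV. ?g j))" for k
    using arg_cong[OF uniform, of "\<lambda>\<rho>. \<rho> $ k"]
    by (simp add: uniform_density_def pure_density_amplitude B sum.distrib sum_subtractf
        sum_distrib_left)
  then have eq: "1 / 6 = 12 * (cmod (?g k))\<^sup>2 + (\<Sum>j\<in>UNIV. (cmod (?g j))\<^sup>2)" for k
    unfolding sum0 by simp
  have same: "cmod (?g k) = cmod (?g l)" for k l
  proof -
    have "(cmod (?g k))\<^sup>2 = (cmod (?g l))\<^sup>2" using eq[of k] eq[of l] by linarith
    then show ?thesis by simp
  qed
  \<comment> \<open>The positions of these six vertices are the sums and differences of two
    coordinate vectors, the configuration of \<open>orthogonal_triple_in_plane\<close>.\<close>
  have g: "?g 9 = a $ 1 + a $ 2" "?g 0 = a $ 1 - a $ 2" "?g 1 = a $ 1 + a $ 3" "?g 5 = a $ 1 - a $ 3"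
    "?g 2 = a $ 2 + a $ 3" "?g 6 = a $ 2 - a $ 3"
    by (simp_all add: position_form_def sum_3)
  have "a $ 1 = 0" "a $ 2 = 0" "a $ 3 = 0"
    using orthogonal_triple_in_plane[of "a $ 1" "a $ 2" "a $ 3"]
      same[of 9 0] same[of 1 5] same[of 2 6] same[of 9 1] same[of 9 2]
    unfolding g by blast+
  then have "?g k = 0" for k by (simp add: position_form_def sum_3)
  with eq[of 0] show False by simp
qed

section \<open>Three ground states with uniform mean density\<close>

text \<open>
  \<open>1 / \<surd>96 = 1 / (\<surd>12 \<surd>8)\<close> normalises the constant function and a coordinate function.
\<close>

definition orbital :: "3 \<Rightarrow> state" where
  "orbital m = wedge (\<chi> i. of_real (1 / sqrt 96)) (\<chi> i. of_real (position i $ m))"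

text \<open>Constants have eigenvalue 0 and coordinate functions eigenvalue 2 under
  \<open>- laplacian\<close>; by \<open>one_body_wedge\<close> the eigenvalues add.\<close>

lemma H0_orbital: "H0 *v orbital m = 2 *s orbital m"
proof -
  have const: "- laplacian *v (\<chi> i. c) = 0" for c
    unfolding vec_eq_iff matrix_vector_mult_def all_vertex vec_lambda_beta hopping_sum neighbours
    by simp
  have lin: "- laplacian *v (\<chi> i. of_real (position i $ m)) = 2 *s (\<chi> i. of_real (position i $ m))"
  proof -
    have "\<forall>m. - laplacian *v (\<chi> i. of_real (position i $ m)) = 2 *s (\<chi> i. of_real (position i $ m))"
      unfolding vec_eq_iff matrix_vector_mult_def all_vertex vec_lambda_beta hopping_sum neighbours forall_3
      by simp
    then show ?thesis by blast
  qed
  show ?thesis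
    unfolding H0_def orbital_def one_body_wedge const lin
    by (simp add: wedge_def vec_eq_iff algebra_simps)
qed

text \<open>The values x of a coordinate sum to 0 and their squares to 8, so summing (x j - x k)^2 /
  96 over \<open>j\<close> gives (8 + 12 (x k)^2) / 96.\<close>

lemma pure_density_orbital: "pure_density (orbital m) $ k = 1 / 12 + (position k $ m)\<^sup>2 / 8"
proof -
  have "(cmod (amplitude (orbital m) k j))\<^sup>2 = (position j $ m - position k $ m)\<^sup>2 / 96" for j
  proof -
    have "amplitude (orbital m) k j = of_real ((position j $ m - position k $ m) / sqrt 96)"
      by (simp add: orbital_def amplitude_wedge diff_divide_distrib)
    then show ?thesis by (simp only: norm_of_real power2_abs power_divide) simp
  qed
  then have "pure_density (orbital m) $ k = (\<Sum>j\<in>UNIV. (position j $ m - position k $ m)\<^sup>2 / 96)"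
    by (simp only: pure_density_amplitude)
  moreover have "\<forall>m k. (\<Sum>j\<in>UNIV. (position j $ m - position k $ m)\<^sup>2 / 96) = 1 / 12 + (position k $ m)\<^sup>2 / 8"
    unfolding forall_3 all_vertex sum_vertex by simp
  ultimately show ?thesis by simp
qed

lemma sum_pure_density: "(\<Sum>k\<in>UNIV. pure_density \<Psi> $ k) = 2 * (norm \<Psi>)\<^sup>2"
  by (simp add: pure_density_amplitude norm_state_amplitude)

lemma sum_pure_density_orbital: "(\<Sum>k\<in>UNIV. pure_density (orbital m) $ k) = 2"
proof -
  have "\<forall>m. (\<Sum>k\<in>UNIV. 1 / 12 + (position k $ m)\<^sup>2 / 8) = 2"
    unfolding forall_3 sum_vertex by simp
  then show ?thesis by (simp add: pure_density_orbital)
qed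

lemma norm_orbital: "norm (orbital m) = 1"
proof -
  have "(norm (orbital m))\<^sup>2 = 1"
    using sum_pure_density[of "orbital m"] by (simp add: sum_pure_density_orbital)
  then show ?thesis by (simp add: power2_eq_1_iff) (smt (verit) norm_ge_zero)
qed

lemma energy_orbital: "inner_prod (orbital m) (H0 *v orbital m) = 2"
  by (simp add: H0_orbital inner_prod_scale_right inner_prod_self norm_orbital)

text \<open>All positions have squared length 2, so the sum is 3/12 + 2/8 = 1/2 at every
  vertex.\<close>

lemma pure_density_orbital_mean: "(\<Sum>m\<in>UNIV. pure_density (orbital m) $ k) = 3 * uniform_density $ k"
proof -
  have "\<forall>k. (\<Sum>m\<in>UNIV. 1 / 12 + (position k $ m)\<^sup>2 / 8) = 1 / 2"
    unfolding all_vertex sum_3 by simp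
  then show ?thesis by (simp add: pure_density_orbital uniform_density_def)
qed

lemma smallest_eigenvalue_H0: "smallest_eigenvalue H0 2"
  unfolding smallest_eigenvalue_def eigenvalue_def
proof (intro conjI allI impI)
  show "\<exists>\<Psi>. \<Psi> \<noteq> 0 \<and> H0 *v \<Psi> = of_real 2 *s \<Psi>"
    using H0_orbital[of 1] norm_orbital[of 1] by (intro exI[of _ "orbital 1"]) auto
next
  fix e assume "\<exists>\<Psi>. \<Psi> \<noteq> 0 \<and> H0 *v \<Psi> = of_real e *s \<Psi>"
  then obtain \<Psi> where "\<Psi> \<noteq> 0" "H0 *v \<Psi> = of_real e *s \<Psi>" by blast
  then have "2 * (norm \<Psi>)\<^sup>2 \<le> e * (norm \<Psi>)\<^sup>2"
    using H0_energy_ge[of \<Psi>] by (simp add: inner_prod_scale_right inner_prod_self)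
  with \<open>\<Psi> \<noteq> 0\<close> show "2 \<le> e" by simp
qed

lemma has_density_mixture_orbital: "has_density (mixture orbital) uniform_density"
  unfolding has_density_def trace_mixture expectation_number_op of_real_sum[symmetric]
    pure_density_orbital_mean by simp

lemma trace_mixture_orbital_H0: "trace (mixture orbital ** H0) = 2"
  by (simp add: trace_mixture energy_orbital)

lemma uniform_density_in_domain:
  "uniform_density \<in> density_domain_strict 2" "uniform_density \<in> density_domain 2"
  by (simp_all add: uniform_density_def density_domain_strict_def density_domain_def)

lemma uniform_density_not_v_representable:
  assumes "ground_state (H0 + potential v) \<Psi>"
  shows "pure_density \<Psi> \<noteq> uniform_density"
proof
  assume uniform: "pure_density \<Psi> = uniform_density"
  let ?H = "H0 + potential v"
  have energy: "Re (inner_prod \<Phi> (?H *v \<Phi>)) =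
      Re (inner_prod \<Phi> (H0 *v \<Phi>)) + (\<Sum>k\<in>UNIV. v $ k * pure_density \<Phi> $ k)" for \<Phi>
    by (simp add: matrix_vector_mult_add_rdistrib inner_prod_add_right expectation_potential)
  have "hermitian H0"
    unfolding H0_def
    by (rule hermitian_one_body) (simp only: hopping_entry, simp add: adjacent_commute)
  then have H0_sym: "H0 $ p $ q = cnj (H0 $ q $ p)" for p q
    unfolding hermitian_def by blast
  have "?H $ p $ q = cnj (?H $ q $ p)" for p q
    using H0_sym[of p q] by (simp add: potential_def)
  then have herm: "hermitian ?H"
    unfolding hermitian_def by blast
  obtain e where e: "smallest_eigenvalue ?H e" and \<Psi>: "?H *v \<Psi> = of_real e *s \<Psi>" and "norm \<Psi> = 1"
    using assms by (auto simp: ground_state_def)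
  \<comment> \<open>Each orbital serves as a trial state. Averaging over the three turns the
    potential term into that of the uniform density, which is also its value at
    \<open>\<Psi>\<close>.\<close>
  have "3 * e \<le> (\<Sum>m\<in>(UNIV :: 3 set). 2 + (\<Sum>k\<in>UNIV. v $ k * pure_density (orbital m) $ k))"
  proof -
    have "e \<le> 2 + (\<Sum>k\<in>UNIV. v $ k * pure_density (orbital m) $ k)" for m
      using smallest_eigenvalue_le_energy[OF herm e, of "orbital m"]
      by (simp add: norm_orbital energy energy_orbital)
    then have "(\<Sum>m\<in>(UNIV :: 3 set). e) \<le> (\<Sum>m\<in>(UNIV :: 3 set). 2 + (\<Sum>k\<in>UNIV. v $ k * pure_density (orbital m) $ k))"
      by (intro sum_mono)
    then show ?thesis by simp
  qed
  also have "\<dots> = 6 + (\<Sum>k\<in>UNIV. v $ k * (\<Sum>m\<in>UNIV. pure_density (orbital m) $ k))"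
    by (simp add: sum.distrib sum_distrib_left) (rule sum.swap)
  also have "\<dots> = 6 + 3 * (\<Sum>k\<in>UNIV. v $ k * uniform_density $ k)"
    by (simp add: pure_density_orbital_mean sum_distrib_left mult_ac)
  finally have "e \<le> 2 + (\<Sum>k\<in>UNIV. v $ k * uniform_density $ k)" by simp
  moreover have "e = Re (inner_prod \<Psi> (H0 *v \<Psi>)) + (\<Sum>k\<in>UNIV. v $ k * uniform_density $ k)"
    using energy[of \<Psi>] by (simp add: \<Psi> inner_prod_scale_right inner_prod_self \<open>norm \<Psi> = 1\<close> uniform)
  ultimately have "Re (inner_prod \<Psi> (H0 *v \<Psi>)) \<le> 2 * (norm \<Psi>)\<^sup>2"
    by (simp add: \<open>norm \<Psi> = 1\<close>)
  then show False using minimal_energy_density_not_uniform uniform by blast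
qed

section \<open>The constrained-search functionals at the uniform density\<close>

lemma F_ens_uniform_le: "F_ens uniform_density \<le> ereal 2"
proof -
  have "ereal 2 \<in> {ereal (Re (trace (\<Gamma> ** H0))) | \<Gamma>. density_matrix \<Gamma> \<and> has_density \<Gamma> uniform_density}"
    using density_matrix_mixture[of orbital] norm_orbital has_density_mixture_orbital trace_mixture_orbital_H0
    by force
  then show ?thesis
    unfolding F_ens_def using uniform_density_in_domain by (simp add: Inf_lower)
qed

lemma F_pure_orbital_le: "F_pure (pure_density (orbital m)) \<le> ereal 2"
proof -
  have "0 \<le> pure_density (orbital m) $ k \<and> pure_density (orbital m) $ k \<le> 1" for k
  proof -
    have "\<forall>m k. (position k $ m)\<^sup>2 \<le> 1" unfolding forall_3 all_vertex by simp
    then have "(position k $ m)\<^sup>2 \<le> 1" by blast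
    then show ?thesis by (simp add: pure_density_orbital)
  qed
  then have "pure_density (orbital m) \<in> density_domain 2"
    by (simp add: density_domain_def sum_pure_density_orbital)
  moreover have "ereal 2 \<in> {ereal (Re (inner_prod \<Psi> (H0 *v \<Psi>))) | \<Psi>.
      norm \<Psi> = 1 \<and> pure_density \<Psi> = pure_density (orbital m)}"
    using norm_orbital[of m] energy_orbital[of m] by force
  ultimately show ?thesis
    unfolding F_pure_def by (simp add: Inf_lower)
qed

text \<open>Every admissible state has energy above 2; the strict bound survives the infimum because
  the energy attains its minimum on the compact set of these states, unless that set is empty and
  the infimum infinite.\<close>

lemma F_pure_uniform_gt: "ereal 2 < F_pure uniform_density"
proof -
  define S where "S = {\<Psi> :: state. norm \<Psi> = 1 \<and> pure_density \<Psi> = uniform_density}"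
  have F: "F_pure uniform_density = (INF \<Psi>\<in>S. ereal (Re (inner_prod \<Psi> (H0 *v \<Psi>))))"
    unfolding F_pure_def S_def using uniform_density_in_domain
    by (simp add: image_def) (metis (mono_tags, lifting))
  have "continuous_on UNIV pure_density"
    unfolding pure_density_def by (intro continuous_intros)
  then have "closed {\<Psi>. pure_density \<Psi> = uniform_density}"
    by (intro closed_Collect_eq) (auto intro: continuous_intros)
  moreover have "S = sphere 0 1 \<inter> {\<Psi>. pure_density \<Psi> = uniform_density}"
    by (auto simp: S_def)
  ultimately have "compact S" using compact_Int_closed[OF compact_sphere] by simp
  show ?thesis
  proof (cases "S = {}")
    case True
    then show ?thesis by (simp add: F top_ereal_def)
  next
    case False
    obtain \<Phi> where "\<Phi> \<in> S"
      and min: "\<forall>\<Psi>\<in>S. Re (inner_prod \<Phi> (H0 *v \<Phi>)) \<le> Re (inner_prod \<Psi> (H0 *v \<Psi>))"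
      using continuous_attains_inf[OF \<open>compact S\<close> False continuous_on_energy] by blast
    have "2 < Re (inner_prod \<Phi> (H0 *v \<Phi>))"
      using minimal_energy_density_not_uniform[of \<Phi>] \<open>\<Phi> \<in> S\<close> by (force simp: S_def)
    also have "ereal \<dots> \<le> F_pure uniform_density"
      unfolding F using min by (intro INF_greatest) simp
    finally show ?thesis by simp
  qed
qed

text \<open>Convexity of sublevel sets, the form in which a bound at the orbital densities passes to
  their mean.\<close>

lemma convex_ereal_le:
  assumes "convex_ereal f" "0 < t" "t < 1" "f x \<le> ereal m" "f y \<le> ereal m"
  shows "f ((1 - t) *\<^sub>R x + t *\<^sub>R y) \<le> ereal m"
proof -
  have "f ((1 - t) *\<^sub>R x + t *\<^sub>R y) \<le> ereal (1 - t) * f x + ereal t * f y"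
    using assms(1-3) unfolding convex_ereal_def by blast
  also have "\<dots> \<le> ereal (1 - t) * ereal m + ereal t * ereal m"
    using assms by (intro add_mono ereal_mult_left_mono) auto
  also have "\<dots> = ereal m" by (simp add: algebra_simps)
  finally show ?thesis .
qed

lemma not_convex_F_pure: "\<not> convex_ereal F_pure"
proof
  assume conv: "convex_ereal F_pure"
  let ?\<rho> = "\<lambda>m. pure_density (orbital m)"
  \<comment> \<open>The mean of three points is reached by two binary combinations: the midpoint of
    the first two, then weights 2/3 and 1/3.\<close>
  let ?mid = "(1 - 1 / 2) *\<^sub>R ?\<rho> 1 + (1 / 2) *\<^sub>R ?\<rho> 2"
  have "F_pure ?mid \<le> ereal 2"
    by (rule convex_ereal_le[OF conv]) (simp_all add: F_pure_orbital_le)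
  then have "F_pure ((1 - 1 / 3) *\<^sub>R ?mid + (1 / 3) *\<^sub>R ?\<rho> 3) \<le> ereal 2"
    by (intro convex_ereal_le[OF conv]) (simp_all add: F_pure_orbital_le)
  also have "(1 - 1 / 3) *\<^sub>R ?mid + (1 / 3) *\<^sub>R ?\<rho> 3 = uniform_density"
  proof -
    have "uniform_density $ k = (?\<rho> 1 $ k + ?\<rho> 2 $ k + ?\<rho> 3 $ k) / 3" for k
      using pure_density_orbital_mean[of k] by (simp add: sum_3)
    then show ?thesis by (simp add: vec_eq_iff algebra_simps add_divide_distrib)
  qed
  finally show False using F_pure_uniform_gt by simp
qed

theorem mainTheorem8:
  shows "uniform_density \<in> density_domain_strict 2 \<and>
    (\<exists>\<Gamma>. ground_state_ensemble H0 \<Gamma> \<and> has_density \<Gamma> uniform_density) \<and>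
    \<not> (\<exists>v \<Psi>. ground_state (H0 + potential v) \<Psi> \<and> pure_density \<Psi> = uniform_density) \<and>
    F_pure \<noteq> F_ens \<and>
    \<not> convex_ereal F_pure"
proof (intro conjI)
  show "uniform_density \<in> density_domain_strict 2"
    by (rule uniform_density_in_domain)
  have "ground_state_ensemble H0 (mixture orbital)"
    unfolding ground_state_ensemble_def
    using density_matrix_mixture[of orbital] norm_orbital smallest_eigenvalue_H0 trace_mixture_orbital_H0
    by (metis of_real_numeral)
  then show "\<exists>\<Gamma>. ground_state_ensemble H0 \<Gamma> \<and> has_density \<Gamma> uniform_density"
    using has_density_mixture_orbital by blast
  show "\<not> (\<exists>v \<Psi>. ground_state (H0 + potential v) \<Psi> \<and> pure_density \<Psi> = uniform_density)"
    using uniform_density_not_v_representable by blast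
  show "F_pure \<noteq> F_ens"
    using F_pure_uniform_gt F_ens_uniform_le by (metis leD)
  show "\<not> convex_ereal F_pure"
    by (rule not_convex_F_pure)
qed

end
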